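(* Let $\Omega\subset\mathbb{R}^n$ be a domain and let $F=(f_1,\dots,f_m):\Omega\to\mathbb{R}^m$ be a smooth map. The $n$-form $\Theta(F)$ on $\Omega\times\mathbb{R}^m$ is closed if and only if the graph $\{(x,F(x)):x\in\Omega\}$ of $F$ is a minimal submanifold of $\mathbb{R}^{n+m}$.
   Context: Minimal means that the mean curvature vector vanishes identically. Definition of $\Theta(F)$ for a smooth map $F:\Omega\subset\mathbb{R}^n\to\mathbb{R}^m$. Fix the standard orientation of $\mathbb{R}^n$; let $\Sigma=\{(x,F(x)):x\in\Omega\}$ be the graph, oriented so that the projection $\pi_1:\Sigma\to\Omega$ preserves orientation, and let $\operatorname{vol}_\Sigma$ be the induced volume form. For $p\in\Sigma$ put $D=\mathrm{d}F|_{\pi_1(p)}:\mathbb{R}^n\to\mathbb{R}^m$, $G=\mathbf{I}_n+D^*D$, $H=\mathbf{I}_m+DD^*$. Define isometric isomorphisms $L_p:\mathbb{R}^n\to T_p\Sigma$, $L_p(v)=(G^{-1/2}v,\,DG^{-1/2}v)$, and $L_p^\perp:\mathbb{R}^m\to N_p\Sigma$, $L_p^\perp(w)=(-D^*H^{-1/2}w,\,H^{-1/2}w)$, onto the tangent and normal spaces, and set $J_p=L_p^\perp\circ D\circ L_p^{-1}:T_p\Sigma\to N_p\Sigma$. For $\xi\in\Lambda^k(\mathbb{R}^n\times\mathbb{R}^m)^*$ at $p$ put $\Psi(\xi)=\sum_{i=1}^n (J_p(e_i))^\flat\wedge\iota_{e_i}\xi$, where $e_1,\dots,e_n$ is any orthonormal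 basis of $T_p\Sigma$ (the result is independent of the basis), $\iota$ is interior multiplication, and $\flat$ is the metric dual. View $\operatorname{vol}_\Sigma$ at $p$ as the $n$-form on $\mathbb{R}^{n+m}$ that vanishes when contracted with normal vectors, and set $\Psi^\ell(F)=\Psi^{\ell}(\operatorname{vol}_\Sigma)$ ($\ell$-fold iterate). This is defined along $\Sigma$ and is extended to an $n$-form on $\Omega\times\mathbb{R}^m$ by parallel transport along the $\mathbb{R}^m$ factor, i.e. its value at $(x,y)$ is its value at $(x,F(x))$. Finally $$\Theta(F)=\Psi^0(F)-\sum_{\ell\ge1}(-1)^\ell\,\frac{\ell-1}{\ell!}\,\Psi^\ell(F).$$ *)

theory Defs
  imports "HOL-Analysis.Analysis"
begin

section \<open>Smooth maps\<close>

(* S is meant to be open.  All iterated directional derivatives of order less than k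
   are differentiable on S and those of order k are continuous, which on an open set is C^k. *)
primrec Ck_on :: "nat \<Rightarrow> 'a::euclidean_space set \<Rightarrow> ('a \<Rightarrow> 'b::euclidean_space) \<Rightarrow> bool" where
  "Ck_on 0 S f \<longleftrightarrow> continuous_on S f"
| "Ck_on (Suc k) S f \<longleftrightarrow> (\<forall>x\<in>S. f differentiable (at x)) \<and>
     (\<forall>v. Ck_on k S (\<lambda>x. frechet_derivative f (at x) v))"

definition smooth_on :: "'a::euclidean_space set \<Rightarrow> ('a \<Rightarrow> 'b::euclidean_space) \<Rightarrow> bool" where
  "smooth_on S f \<longleftrightarrow> (\<forall>k. Ck_on k S f)"


section \<open>Exterior algebra and differential forms on a Euclidean space\<close>

(* An alternating k-form is represented by its values on lists of k vectors, so that the degree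
   is the length of the argument list; only lists of that length are ever relevant. *)
type_synonym 'v form = "'v list \<Rightarrow> real"

definition omit :: "nat \<Rightarrow> 'a list \<Rightarrow> 'a list" where
  "omit i vs = take i vs @ drop (Suc i) vs"

definition interior_mult :: "'v \<Rightarrow> 'v form \<Rightarrow> 'v form" where
  "interior_mult e \<xi> = (\<lambda>vs. \<xi> (e # vs))"

(* The exterior product of a 1-form with a form, in the determinant normalisation, i.e. with
   (a_1 wedge ... wedge a_k)(v_1,...,v_k) = det (a_i(v_j)) and no factor 1/k!. *)
definition wedge1 :: "('v \<Rightarrow> real) \<Rightarrow> 'v form \<Rightarrow> 'v form" where
  "wedge1 \<alpha> \<xi> = (\<lambda>vs. \<Sum>i<length vs. (-1) ^ i * \<alpha> (vs ! i) * \<xi> (omit i vs))"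

primrec wedge_list :: "('v \<Rightarrow> real) list \<Rightarrow> 'v form" where
  "wedge_list [] = (\<lambda>vs. if vs = [] then 1 else 0)"
| "wedge_list (\<alpha> # as) = wedge1 \<alpha> (wedge_list as)"

definition flat :: "'v::real_inner \<Rightarrow> 'v \<Rightarrow> real" where
  "flat a = (\<lambda>v. a \<bullet> v)"

(* The value of the exterior derivative on constant vector fields v_0,...,v_k. *)
definition ext_deriv :: "('v::euclidean_space \<Rightarrow> 'v form) \<Rightarrow> 'v \<Rightarrow> 'v form" where
  "ext_deriv \<omega> z = (\<lambda>vs. \<Sum>i<length vs. (-1) ^ i *
     frechet_derivative (\<lambda>y. \<omega> y (omit i vs)) (at z) (vs ! i))"

(* Differentiability is part of the notion, so that the exterior derivative is meaningful. *)
definition closed_form_on :: "nat \<Rightarrow> 'v::euclidean_space set \<Rightarrow> ('v \<Rightarrow> 'v form) \<Rightarrow> bool" where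
  "closed_form_on k S \<omega> \<longleftrightarrow>
     (\<forall>vs. length vs = k \<longrightarrow> (\<forall>z\<in>S. (\<lambda>y. \<omega> y vs) differentiable (at z))) \<and>
     (\<forall>vs. length vs = Suc k \<longrightarrow> (\<forall>z\<in>S. ext_deriv \<omega> z vs = 0))"

(* dx_1 wedge ... wedge dx_n; the order of the coordinates is that of the index type, and the
   sign of this form is the standard orientation of R^n. *)
definition std_vol :: "(real, 'n::{finite,linorder}) vec form" where
  "std_vol = wedge_list (map (\<lambda>i v. v $ i) (sorted_list_of_set UNIV))"


section \<open>Parametrised submanifolds and minimality\<close>

definition orthonormal_basis_of :: "'v::euclidean_space set \<Rightarrow> 'v list \<Rightarrow> bool" where
  "orthonormal_basis_of T es \<longleftrightarrow> span (set es) = T \<and>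
     (\<forall>i<length es. \<forall>j<length es. es ! i \<bullet> es ! j = (if i = j then 1 else 0))"

definition tangent_space :: "('a::euclidean_space \<Rightarrow> 'v::euclidean_space) \<Rightarrow> 'a \<Rightarrow> 'v set" where
  "tangent_space \<phi> x = range (frechet_derivative \<phi> (at x))"

definition normal_part :: "'v::euclidean_space set \<Rightarrow> 'v \<Rightarrow> 'v" where
  "normal_part T v = (THE w. w \<in> T\<^sup>\<bottom> \<and> v - w \<in> T)"

(* II(X,Y) is the normal part of the ambient derivative, in direction X, of a tangential extension
   of Y.  With X = d phi(u) and Y = d phi(v) for constant u, v, the extension d phi(v) is used and
   the ambient derivative is the second derivative of phi in the directions u, v. *)
definition second_fundamental_form ::
  "('a::euclidean_space \<Rightarrow> 'v::euclidean_space) \<Rightarrow> 'a \<Rightarrow> 'v \<Rightarrow> 'v \<Rightarrow> 'v" where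
  "second_fundamental_form \<phi> x X Y =
     (let u = inv (frechet_derivative \<phi> (at x)) X; v = inv (frechet_derivative \<phi> (at x)) Y
      in normal_part (tangent_space \<phi> x)
           (frechet_derivative (\<lambda>y. frechet_derivative \<phi> (at y) v) (at x) u))"

(* The trace does not depend on the orthonormal basis chosen. *)
definition mean_curvature :: "('a::euclidean_space \<Rightarrow> 'v::euclidean_space) \<Rightarrow> 'a \<Rightarrow> 'v" where
  "mean_curvature \<phi> x =
     (let es = (SOME es. orthonormal_basis_of (tangent_space \<phi> x) es)
      in (1 / real DIM('a)) *\<^sub>R (\<Sum>e\<leftarrow>es. second_fundamental_form \<phi> x e e))"

(* Minimality of the submanifold phi(U), for an immersion phi that is injective on U. *)
definition minimal_on :: "'a::euclidean_space set \<Rightarrow> ('a \<Rightarrow> 'v::euclidean_space) \<Rightarrow> bool" where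
  "minimal_on U \<phi> \<longleftrightarrow> (\<forall>x\<in>U. mean_curvature \<phi> x = 0)"


section \<open>The form \<open>\<Theta>(F)\<close>\<close>

definition graph_map :: "('a \<Rightarrow> 'b) \<Rightarrow> 'a \<Rightarrow> 'a \<times> 'b" where
  "graph_map F x = (x, F x)"

definition pos_def_op :: "('a::euclidean_space \<Rightarrow> 'a) \<Rightarrow> bool" where
  "pos_def_op A \<longleftrightarrow> linear A \<and> (\<forall>u v. A u \<bullet> v = u \<bullet> A v) \<and> (\<forall>v. v \<noteq> 0 \<longrightarrow> 0 < A v \<bullet> v)"

(* A^(-1/2) for a positive definite A: the positive definite square root of the inverse. *)
definition inv_sqrt :: "('a::euclidean_space \<Rightarrow> 'a) \<Rightarrow> 'a \<Rightarrow> 'a" where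
  "inv_sqrt A = (THE S. pos_def_op S \<and> S \<circ> S = inv A)"

(* The operators at a point are written in terms of D, the derivative of F there. *)
definition G_op :: "('a::euclidean_space \<Rightarrow> 'b::euclidean_space) \<Rightarrow> 'a \<Rightarrow> 'a" where
  "G_op D = (\<lambda>v. v + adjoint D (D v))"

definition H_op :: "('a::euclidean_space \<Rightarrow> 'b::euclidean_space) \<Rightarrow> 'b \<Rightarrow> 'b" where
  "H_op D = (\<lambda>w. w + D (adjoint D w))"

definition L_tan :: "('a::euclidean_space \<Rightarrow> 'b::euclidean_space) \<Rightarrow> 'a \<Rightarrow> 'a \<times> 'b" where
  "L_tan D v = (inv_sqrt (G_op D) v, D (inv_sqrt (G_op D) v))"

definition L_nor :: "('a::euclidean_space \<Rightarrow> 'b::euclidean_space) \<Rightarrow> 'b \<Rightarrow> 'a \<times> 'b" where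
  "L_nor D w = (- adjoint D (inv_sqrt (H_op D) w), inv_sqrt (H_op D) w)"

(* Only to be applied to tangent vectors, i.e. elements of the range of L_tan D. *)
definition J_op :: "('a::euclidean_space \<Rightarrow> 'b::euclidean_space) \<Rightarrow> 'a \<times> 'b \<Rightarrow> 'a \<times> 'b" where
  "J_op D = L_nor D \<circ> D \<circ> inv (L_tan D)"

(* A positively oriented orthonormal basis of the tangent space of the graph at (x, F x).  The
   projection to the first factor preserves orientation, so its image is a positive basis of R^n. *)
definition oriented_frame ::
  "((real, 'n::{finite,linorder}) vec \<Rightarrow> (real, 'm::finite) vec) \<Rightarrow> (real, 'n) vec \<Rightarrow> ((real, 'n) vec \<times> (real, 'm) vec) list" where
  "oriented_frame F x = (SOME es. orthonormal_basis_of (tangent_space (graph_map F) x) es \<and>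
     0 < std_vol (map fst es))"

(* The induced volume form at (x, F x) as an n-form on the ambient space: the exterior product of
   the dual coframe.  The covectors flat e kill the normal space since each e is tangent.
   It does not depend on the frame chosen, and neither does Psi below. *)
definition vol_graph ::
  "((real, 'n::{finite,linorder}) vec \<Rightarrow> (real, 'm::finite) vec) \<Rightarrow> (real, 'n) vec \<Rightarrow> ((real, 'n) vec \<times> (real, 'm) vec) form" where
  "vol_graph F x = wedge_list (map flat (oriented_frame F x))"

definition Psi ::
  "((real, 'n::{finite,linorder}) vec \<Rightarrow> (real, 'm::finite) vec) \<Rightarrow> (real, 'n) vec
    \<Rightarrow> ((real, 'n) vec \<times> (real, 'm) vec) form \<Rightarrow> ((real, 'n) vec \<times> (real, 'm) vec) form" where
  "Psi F x \<xi> = (\<lambda>vs. \<Sum>e\<leftarrow>oriented_frame F x.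
     wedge1 (flat (J_op (frechet_derivative F (at x)) e)) (interior_mult e \<xi>) vs)"

(* Extended from the graph by parallel transport in the second factor: the value at z = (x, y)
   is the value at (x, F x). *)
definition Psi_pow ::
  "nat \<Rightarrow> ((real, 'n::{finite,linorder}) vec \<Rightarrow> (real, 'm::finite) vec)
    \<Rightarrow> (real, 'n) vec \<times> (real, 'm) vec \<Rightarrow> ((real, 'n) vec \<times> (real, 'm) vec) form" where
  "Psi_pow l F z = (Psi F (fst z) ^^ l) (vol_graph F (fst z))"

(* The sum is finite, since Psi_pow l F vanishes for l > n. *)
definition Theta_form ::
  "((real, 'n::{finite,linorder}) vec \<Rightarrow> (real, 'm::finite) vec)
    \<Rightarrow> (real, 'n) vec \<times> (real, 'm) vec \<Rightarrow> ((real, 'n) vec \<times> (real, 'm) vec) form" where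
  "Theta_form F z = (\<lambda>vs. Psi_pow 0 F z vs -
     (\<Sum>\<^sub>\<infinity>l\<in>{1..}. (-1) ^ l * ((real l - 1) / fact l) * Psi_pow l F z vs))"

end

theory Submission
  imports Defs
begin

text \<open>
  Write \<open>D = dF\<close>, \<open>G = I + D\<^sup>*D\<close>, \<open>g = det G\<close>. The intertwining relation \<open>D G\<^sup>-\<^sup>1\<^sup>/\<^sup>2 = H\<^sup>-\<^sup>1\<^sup>/\<^sup>2 D\<close> gives
  \<open>J(u, Du) = (-D\<^sup>*Du, Du)\<close>, so \<open>e - Je\<close> is horizontal for tangent \<open>e\<close>. As \<open>\<Psi>\<close> is a derivation whose
  square vanishes on tangent covectors, \<open>\<Theta> = (1 + \<Psi>) exp(-\<Psi>) vol\<close>, and \<open>exp(-\<Psi>) vol\<close> is the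
  exterior product of the covectors \<open>e - Je\<close> over a frame, which is \<open>\<surd>g dx\<close>. Hence
  \<open>\<Theta> = q(x) dx + \<Sum> B\<^sub>a\<^sub>k(x) dx[dx\<^sub>k := dy\<^sub>a]\<close> with \<open>B = \<surd>g D G\<^sup>-\<^sup>1\<close>, which is closed iff every row of \<open>B\<close>
  is divergence free. Finally \<open>div B = \<surd>g (I + DD\<^sup>*)\<^sup>-\<^sup>1 R\<close> with \<open>R = \<Sum> g\<^sup>j\<^sup>k \<partial>\<^sub>j\<partial>\<^sub>k F\<close>, while the mean curvature
  is a multiple of the normal part of \<open>(0, R)\<close>, which vanishes iff \<open>R = 0\<close>.
\<close>

section \<open>Exterior products with covectors\<close>

text \<open>The coefficients of Theta come from
  \<open>-(l - 1) / l! = 1 / l! - 1 / (l - 1)!\<close>: the first part, together with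
  \<open>Psi^0\<close>, sums to \<open>exp(-Psi)\<close>, the second to
  \<open>Psi exp(-Psi)\<close>. Since \<open>exp(-Psi) vol\<close> contains no dy at all, the one
  remaining Psi creates at most one factor dy, and closedness becomes a first-order condition on the
  coefficients alone. The matrix B is the derivative of the area density \<open>sqrt g\<close> with
  respect to the entries of D, so that \<open>div B = 0\<close> is the Euler-Lagrange system of the
  area functional; its link with mean curvature is obtained here by direct computation, not by a
  variation. The obstacle is regularity: the oriented frame is chosen separately at each point, and
  the inverse square roots are definite descriptions, so neither is known to depend differentiably
  on x. Both are therefore eliminated by linear algebra at a fixed point before anything is
  differentiated. The frame disappears because the sum of \<open>fst e\<close> tensor
  \<open>fst e\<close> over it is the inverse of G; its orientation only selects the positive root
  of g.\<close>

lemma wedge1_Nil [simp]: "wedge1 \<alpha> \<xi> [] = 0"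
  by (simp add: wedge1_def)

text \<open>The antiderivation rule of interior multiplication. It allows identities between forms
  to be proved by induction on the argument list, without index computations with
  \<open>omit\<close>.\<close>

lemma wedge1_Cons: "wedge1 \<alpha> \<xi> (e # vs) = \<alpha> e * \<xi> vs - wedge1 \<alpha> (interior_mult e \<xi>) vs"
proof -
  have "wedge1 \<alpha> \<xi> (e # vs) = (\<Sum>i<Suc (length vs). (-1) ^ i * \<alpha> ((e # vs) ! i) * \<xi> (omit i (e # vs)))"
    by (simp add: wedge1_def)
  also have "\<dots> = \<alpha> e * \<xi> vs + (\<Sum>i<length vs. (-1) ^ Suc i * \<alpha> (vs ! i) * \<xi> (e # omit i vs))"
    by (subst sum.lessThan_Suc_shift) (simp add: omit_def)
  also have "\<dots> = \<alpha> e * \<xi> vs - wedge1 \<alpha> (interior_mult e \<xi>) vs"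
    by (simp add: wedge1_def interior_mult_def sum_negf)
  finally show ?thesis .
qed

lemma interior_mult_wedge1:
  "interior_mult e (wedge1 \<alpha> \<xi>) = (\<lambda>vs. \<alpha> e * \<xi> vs - wedge1 \<alpha> (interior_mult e \<xi>) vs)"
  by (simp add: fun_eq_iff interior_mult_def[of e "wedge1 \<alpha> \<xi>"] wedge1_Cons)

lemma wedge1_zero_left [simp]: "wedge1 (\<lambda>v. 0) \<xi> = (\<lambda>vs. 0)"
  by (simp add: wedge1_def fun_eq_iff)

lemma wedge1_zero_right [simp]: "wedge1 \<alpha> (\<lambda>vs. 0) = (\<lambda>vs. 0)"
  by (simp add: wedge1_def fun_eq_iff)

lemma wedge1_sum_left:
  "wedge1 (\<lambda>v. \<Sum>i\<in>I. c i * \<alpha> i v) \<xi> vs = (\<Sum>i\<in>I. c i * wedge1 (\<alpha> i) \<xi> vs)"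
  unfolding wedge1_def sum_distrib_left sum_distrib_right
  by (subst sum.swap) (simp add: mult_ac)

lemma wedge1_add_left:
  "wedge1 (\<lambda>v. \<alpha> v + c * \<beta> v) \<xi> vs = wedge1 \<alpha> \<xi> vs + c * wedge1 \<beta> \<xi> vs"
  by (simp add: wedge1_def sum_distrib_left sum.distrib algebra_simps)

lemma wedge1_sum_right:
  "wedge1 \<alpha> (\<lambda>vs. \<Sum>i\<in>I. c i * \<xi> i vs) vs = (\<Sum>i\<in>I. c i * wedge1 \<alpha> (\<xi> i) vs)"
  unfolding wedge1_def sum_distrib_left sum_distrib_right
  by (subst sum.swap) (simp add: mult_ac)

lemma wedge1_add_right:
  "wedge1 \<alpha> (\<lambda>vs. \<xi> vs + c * \<eta> vs) vs = wedge1 \<alpha> \<xi> vs + c * wedge1 \<alpha> \<eta> vs"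
  by (simp add: wedge1_def sum_distrib_left sum.distrib algebra_simps)

lemma wedge1_diff_right:
  "wedge1 \<alpha> (\<lambda>vs. c * \<xi> vs - \<eta> vs) vs = c * wedge1 \<alpha> \<xi> vs - wedge1 \<alpha> \<eta> vs"
  by (simp add: wedge1_def sum_distrib_left sum_subtractf algebra_simps)

lemma wedge1_scale_right: "wedge1 \<alpha> (\<lambda>vs. c * \<xi> vs) vs = c * wedge1 \<alpha> \<xi> vs"
  by (simp add: wedge1_def sum_distrib_left algebra_simps)

text \<open>Expanding both sides along the first argument, the head terms agree and the remainder is
  the claim for \<open>interior_mult e \<xi>\<close>; hence the induction with \<xi>
  arbitrary.\<close>

lemma wedge1_anticommute: "wedge1 \<alpha> (wedge1 \<beta> \<xi>) vs = - wedge1 \<beta> (wedge1 \<alpha> \<xi>) vs"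
proof (induction vs arbitrary: \<xi>)
  case (Cons e vs)
  then show ?case
    by (simp add: wedge1_Cons interior_mult_wedge1 wedge1_diff_right)
qed simp

lemma wedge1_self [simp]: "wedge1 \<alpha> (wedge1 \<alpha> \<xi>) = (\<lambda>vs. 0)"
  using wedge1_anticommute[of \<alpha> \<alpha> \<xi>] by (auto simp: fun_eq_iff)

lemma wedge1_wedge_list_member: "\<beta> \<in> set as \<Longrightarrow> wedge1 \<beta> (wedge_list as) = (\<lambda>vs. 0)"
proof (induction as)
  case (Cons \<alpha> as)
  show ?case
  proof (cases "\<beta> = \<alpha>")
    case False
    with Cons have "wedge1 \<beta> (wedge_list as) = (\<lambda>vs. 0)" by simp
    then show ?thesis by (intro ext) (simp add: wedge1_anticommute[of \<beta> \<alpha>])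
  qed simp
qed simp

lemma wedge_list_not_distinct: "\<not> distinct as \<Longrightarrow> wedge_list as = (\<lambda>vs. 0)"
  by (induction as) (auto simp: wedge1_wedge_list_member)

lemma wedge_list_update_sum:
  assumes "i < length as"
  shows "wedge_list (as[i := (\<lambda>v. \<Sum>k\<in>I. c k * \<alpha> k v)]) vs = (\<Sum>k\<in>I. c k * wedge_list (as[i := \<alpha> k]) vs)"
  using assms
proof (induction as arbitrary: i vs)
  case (Cons a as)
  show ?case
  proof (cases i)
    case 0
    then show ?thesis by (simp add: wedge1_sum_left)
  next
    case (Suc j)
    then have "wedge_list (as[j := (\<lambda>v. \<Sum>k\<in>I. c k * \<alpha> k v)]) =
        (\<lambda>vs. \<Sum>k\<in>I. c k * wedge_list (as[j := \<alpha> k]) vs)"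
      using Cons by auto
    then show ?thesis using Suc by (simp add: wedge1_sum_right)
  qed
qed simp

lemma wedge_list_update_add:
  assumes "i < length as"
  shows "wedge_list (as[i := (\<lambda>v. \<alpha> v + c * \<beta> v)]) vs =
    wedge_list (as[i := \<alpha>]) vs + c * wedge_list (as[i := \<beta>]) vs"
proof -
  \<comment> \<open>A two-term sum is written as a sum over \<open>bool\<close>, so that the rule
    for sums applies.\<close>
  have "(\<lambda>v. \<alpha> v + c * \<beta> v) = (\<lambda>v. \<Sum>k\<in>UNIV. (if k then 1 else c) * (if k then \<alpha> else \<beta>) v)"
    by (auto simp: UNIV_bool)
  then show ?thesis
    by (simp only: wedge_list_update_sum[OF assms]) (simp add: UNIV_bool)
qed

lemma wedge_list_compose: "wedge_list (map (\<lambda>\<alpha> v. \<alpha> (g v)) as) vs = wedge_list as (map g vs)"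
proof (induction as arbitrary: vs)
  case (Cons a as)
  have "omit i (map g vs) = map g (omit i vs)" for i
    by (simp add: omit_def take_map drop_map)
  then show ?case
    using Cons by (simp add: wedge1_def)
qed simp

text \<open>Polarisation: with \<open>as ! i + \<gamma>\<close> both in slot \<open>i\<close> and as
  the outer factor the product is zero, and two of its four terms vanish by themselves. It is later
  used to interchange dx_k and dy_a.\<close>

lemma wedge_list_update_swap:
  assumes "i < length as"
  shows "wedge1 (as ! i) (wedge_list (as[i := \<gamma>])) vs = - wedge1 \<gamma> (wedge_list as) vs"
proof -
  let ?s = "\<lambda>v. (as ! i) v + 1 * \<gamma> v"
  have up: "wedge_list (as[i := ?s]) = (\<lambda>vs. wedge_list as vs + 1 * wedge_list (as[i := \<gamma>]) vs)"
    using wedge_list_update_add[OF assms, of "as ! i" 1 \<gamma>] by (simp add: fun_eq_iff)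
  have "?s \<in> set (as[i := ?s])" "as ! i \<in> set as" "\<gamma> \<in> set (as[i := \<gamma>])"
    using assms by (simp_all add: set_update_memI)
  then have "wedge1 ?s (wedge_list (as[i := ?s])) vs = 0"
     "wedge1 (as ! i) (wedge_list as) vs = 0" "wedge1 \<gamma> (wedge_list (as[i := \<gamma>])) vs = 0"
    by (simp_all only: wedge1_wedge_list_member)
  then show ?thesis
    unfolding up wedge1_add_left wedge1_add_right by simp
qed

lemma interior_mult_wedge_list_zero:
  assumes "\<And>\<alpha>. \<alpha> \<in> set as \<Longrightarrow> \<alpha> e = 0"
  shows "interior_mult e (wedge_list as) = (\<lambda>vs. 0)"
  using assms by (induction as) (auto simp: interior_mult_wedge1 interior_mult_def[of e "\<lambda>vs. _ vs"])

text \<open>The covectors after the first kill the first vector, so expansion along that vector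
  leaves a single term.\<close>

lemma wedge_list_dual:
  assumes "length as = length vs"
    and "\<And>i j. i < length as \<Longrightarrow> j < length vs \<Longrightarrow> (as ! i) (vs ! j) = (if i = j then 1 else 0)"
  shows "wedge_list as vs = 1"
  using assms
proof (induction as vs rule: list_induct2)
  case (Cons \<alpha> as v vs)
  have "(as ! i) (vs ! j) = (if i = j then 1 else 0)" if "i < length as" "j < length vs" for i j
    using Cons.prems[of "Suc i" "Suc j"] that by simp
  then have 1: "wedge_list as vs = 1" by (rule Cons.IH)
  have "\<beta> v = 0" if "\<beta> \<in> set as" for \<beta>
    using that Cons.prems[of "Suc _" 0] by (auto simp: in_set_conv_nth)
  then have "interior_mult v (wedge_list as) = (\<lambda>vs. 0)"
    by (rule interior_mult_wedge_list_zero)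
  then show ?case
    using 1 Cons.prems[of 0 0] by (simp add: wedge1_Cons)
qed simp

section \<open>The derivation Psi on exterior products of covectors\<close>

text \<open>The coefficient of \<open>t^k\<close> in the exterior product of the covectors
  \<open>flat (a + t *\<^sub>R P a)\<close>: exactly \<open>k\<close> factors are replaced by their
  images. The factor \<open>of_bool\<close> guards against \<open>k - 1 = 0\<close> at
  \<open>k = 0\<close>.\<close>

primrec partial_wedge :: "('v::real_inner \<Rightarrow> 'v) \<Rightarrow> 'v list \<Rightarrow> nat \<Rightarrow> 'v form" where
  "partial_wedge P [] k = (\<lambda>vs. if k = 0 \<and> vs = [] then 1 else 0)"
| "partial_wedge P (a # as) k = (\<lambda>vs. wedge1 (flat a) (partial_wedge P as k) vs +
     of_bool (k \<noteq> 0) * wedge1 (flat (P a)) (partial_wedge P as (k - 1)) vs)"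

text \<open>\<open>Psi\<close> with the frame and \<open>J\<close> as parameters, which separates
  the algebra from the choice of frame.\<close>

definition replace_deriv :: "('v::real_inner \<Rightarrow> 'v) \<Rightarrow> 'v list \<Rightarrow> 'v form \<Rightarrow> 'v form" where
  "replace_deriv J es \<xi> = (\<lambda>vs. \<Sum>e\<leftarrow>es. wedge1 (flat (J e)) (interior_mult e \<xi>) vs)"

text \<open>The map by which \<open>replace_deriv\<close> acts on covectors. For orthonormal
  \<open>es\<close> it agrees with \<open>J\<close> on \<open>es\<close> and kills the orthogonal
  complement, so it extends a map given only on tangent vectors to the whole space.\<close>

definition extend_frame :: "('v::real_inner \<Rightarrow> 'v) \<Rightarrow> 'v list \<Rightarrow> 'v \<Rightarrow> 'v" where
  "extend_frame J es a = (\<Sum>e\<leftarrow>es. (e \<bullet> a) *\<^sub>R J e)"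

lemma wedge1_flat_add_scaleR:
  "wedge1 (flat (a + c *\<^sub>R b)) \<xi> vs = wedge1 (flat a) \<xi> vs + c * wedge1 (flat b) \<xi> vs"
proof -
  have "flat (a + c *\<^sub>R b) = (\<lambda>v. flat a v + c * flat b v)"
    by (simp add: flat_def fun_eq_iff inner_add_left)
  then show ?thesis by (simp add: wedge1_add_left)
qed

lemma replace_deriv_add:
  "replace_deriv J es (\<lambda>vs. \<xi> vs + c * \<eta> vs) vs = replace_deriv J es \<xi> vs + c * replace_deriv J es \<eta> vs"
proof -
  have i: "interior_mult e (\<lambda>vs. \<xi> vs + c * \<eta> vs) = (\<lambda>vs. interior_mult e \<xi> vs + c * interior_mult e \<eta> vs)" for e
    by (simp add: interior_mult_def)
  show ?thesis
    by (induction es) (simp_all add: replace_deriv_def i wedge1_add_right algebra_simps)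
qed

lemma replace_deriv_zero [simp]: "replace_deriv J es (\<lambda>vs. 0) = (\<lambda>vs. 0)"
proof -
  have i: "interior_mult e (\<lambda>vs. 0::real) = (\<lambda>vs. 0)" for e :: 'a
    by (simp add: interior_mult_def)
  show ?thesis by (simp add: replace_deriv_def i)
qed

lemma replace_deriv_scale: "replace_deriv J es (\<lambda>vs. c * \<xi> vs) vs = c * replace_deriv J es \<xi> vs"
  using replace_deriv_add[of J es "\<lambda>vs. 0" c \<xi>] by simp

lemma replace_deriv_sum:
  assumes "finite I"
  shows "replace_deriv J es (\<lambda>vs. \<Sum>k\<in>I. c k * \<xi> k vs) vs = (\<Sum>k\<in>I. c k * replace_deriv J es (\<xi> k) vs)"
  using assms
proof (induction I arbitrary: vs)
  case (insert k I)
  have "replace_deriv J es (\<lambda>vs. (\<Sum>k\<in>I. c k * \<xi> k vs) + c k * \<xi> k vs) vs = 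
      replace_deriv J es (\<lambda>vs. (\<Sum>k\<in>I. c k * \<xi> k vs)) vs + c k * replace_deriv J es (\<xi> k) vs"
    by (rule replace_deriv_add)
  with insert show ?case
    by (simp add: add.commute)
qed simp

text \<open>The Leibniz rule without sign: the sign from moving \<open>interior_mult e\<close> past
  \<open>flat a\<close> cancels the one from moving \<open>flat (J e)\<close> past it.\<close>

lemma replace_deriv_wedge1:
  "replace_deriv J es (wedge1 (flat a) \<xi>) vs =
    wedge1 (flat (extend_frame J es a)) \<xi> vs + wedge1 (flat a) (replace_deriv J es \<xi>) vs"
proof (induction es)
  case Nil
  have "flat 0 = (\<lambda>v::'a. 0)" by (simp add: flat_def)
  then show ?case by (simp add: replace_deriv_def extend_frame_def)
next
  case (Cons e es)
  have "wedge1 (flat a) (replace_deriv J (e # es) \<xi>) vs =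
      wedge1 (flat a) (\<lambda>vs. replace_deriv J es \<xi> vs + 1 * wedge1 (flat (J e)) (interior_mult e \<xi>) vs) vs"
    by (simp add: replace_deriv_def add.commute)
  also have "\<dots> = wedge1 (flat a) (replace_deriv J es \<xi>) vs - wedge1 (flat (J e)) (wedge1 (flat a) (interior_mult e \<xi>)) vs"
    unfolding wedge1_add_right by (simp add: wedge1_anticommute[of "flat a"])
  finally have 1: "wedge1 (flat a) (replace_deriv J (e # es) \<xi>) vs = \<dots>" .
  have 2: "wedge1 (flat (extend_frame J (e # es) a)) \<xi> vs = 
     wedge1 (flat (extend_frame J es a)) \<xi> vs + (e \<bullet> a) * wedge1 (flat (J e)) \<xi> vs"
    using wedge1_flat_add_scaleR[of "extend_frame J es a" "e \<bullet> a" "J e" \<xi> vs]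
    by (simp add: extend_frame_def add.commute)
  have 3: "replace_deriv J (e # es) (wedge1 (flat a) \<xi>) vs = 
     wedge1 (flat (J e)) (\<lambda>vs. (e \<bullet> a) * \<xi> vs - wedge1 (flat a) (interior_mult e \<xi>) vs) vs 
     + replace_deriv J es (wedge1 (flat a) \<xi>) vs"
    by (simp add: replace_deriv_def interior_mult_wedge1 flat_def inner_commute)
  show ?case
    unfolding 1 2 3 wedge1_diff_right Cons.IH by simp
qed

lemma replace_deriv_wedge_Nil [simp]: "replace_deriv J es (wedge_list []) = (\<lambda>vs. 0)"
proof -
  have i: "interior_mult e (wedge_list []) = (\<lambda>vs. 0)" for e :: 'a
    by (simp add: interior_mult_def)
  show ?thesis unfolding replace_deriv_def i by simp
qed

lemma replace_deriv_wedge_list: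
  "replace_deriv J es (wedge_list (map flat as)) vs =
    (\<Sum>i<length as. wedge_list ((map flat as)[i := flat (extend_frame J es (as ! i))]) vs)"
proof (induction as arbitrary: vs)
  case (Cons a as)
  then have IH: "replace_deriv J es (wedge_list (map flat as)) =
     (\<lambda>vs. \<Sum>i<length as. 1 * wedge_list ((map flat as)[i := flat (extend_frame J es (as ! i))]) vs)"
    by auto
  show ?case
    by (simp only: list.map wedge_list.simps replace_deriv_wedge1 IH wedge1_sum_right)
      (simp add: sum.lessThan_Suc_shift del: sum.lessThan_Suc)
qed (simp add: replace_deriv_wedge_Nil[simplified])

lemma partial_wedge_0: "partial_wedge P as 0 = wedge_list (map flat as)"
  by (induction as) auto

lemma partial_wedge_beyond: "k > length as \<Longrightarrow> partial_wedge P as k = (\<lambda>vs. 0)"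
proof (induction as arbitrary: k)
  case (Cons a as)
  then have "partial_wedge P as k = (\<lambda>vs. 0)" "partial_wedge P as (k - 1) = (\<lambda>vs. 0)"
    by auto
  then show ?case by simp
qed simp

text \<open>Already replaced factors are killed and each other factor can be replaced; every choice
  of \<open>k + 1\<close> replaced factors arises from \<open>k + 1\<close> choices of
  \<open>k\<close>, whence the factor \<open>Suc k\<close>.\<close>

lemma replace_deriv_partial_wedge:
  assumes "\<And>a. a \<in> set as \<Longrightarrow> extend_frame J es a = P a"
    and "\<And>a. a \<in> set as \<Longrightarrow> extend_frame J es (P a) = 0"
  shows "replace_deriv J es (partial_wedge P as k) vs = real (Suc k) * partial_wedge P as (Suc k) vs"
  using assms
proof (induction as arbitrary: k vs)
  case Nil
  then show ?case 
    using replace_deriv_wedge_Nil[of J es, THEN fun_cong, of vs] by (cases "k = 0") simp_all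
next
  case (Cons a as)
  have f0: "flat 0 = (\<lambda>v::'a. 0)" by (simp add: flat_def)
  have IH: "replace_deriv J es (partial_wedge P as k) = (\<lambda>vs. real (Suc k) * partial_wedge P as (Suc k) vs)" for k
    using Cons by auto
  have "replace_deriv J es (partial_wedge P (a # as) k) vs =
     wedge1 (flat (P a)) (partial_wedge P as k) vs + real (Suc k) * wedge1 (flat a) (partial_wedge P as (Suc k)) vs
     + of_bool (k \<noteq> 0) * wedge1 (flat (P a)) (replace_deriv J es (partial_wedge P as (k - 1))) vs"
    using Cons.prems
    by (simp only: partial_wedge.simps replace_deriv_add replace_deriv_wedge1 IH wedge1_scale_right)
       (simp add: f0)
  also have "\<dots> = real (Suc k) * partial_wedge P (a # as) (Suc k) vs"
    by (cases k) (simp_all only: IH wedge1_scale_right, simp_all add: algebra_simps)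
  finally show ?case .
qed

lemma sum_partial_wedge:
  "(\<Sum>k\<le>length as. t ^ k * partial_wedge P as k vs) = wedge_list (map (\<lambda>a. flat (a + t *\<^sub>R P a)) as) vs"
proof (induction as arbitrary: vs)
  case (Cons a as)
  let ?n = "length as"
  have IH: "wedge_list (map (\<lambda>a. flat (a + t *\<^sub>R P a)) as) = (\<lambda>vs. \<Sum>k\<le>?n. t ^ k * partial_wedge P as k vs)"
    using Cons by auto
  have A: "(\<Sum>k\<le>Suc ?n. t ^ k * wedge1 (flat a) (partial_wedge P as k) vs) =
     (\<Sum>k\<le>?n. t ^ k * wedge1 (flat a) (partial_wedge P as k) vs)"
    by (simp add: partial_wedge_beyond)
  have B: "(\<Sum>k\<le>Suc ?n. t ^ k * (of_bool (k \<noteq> 0) * wedge1 (flat (P a)) (partial_wedge P as (k - 1)) vs)) =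
     t * (\<Sum>k\<le>?n. t ^ k * wedge1 (flat (P a)) (partial_wedge P as k) vs)"
    by (subst sum.atMost_Suc_shift) (simp add: sum_distrib_left mult_ac)
  have "(\<Sum>k\<le>Suc ?n. t ^ k * partial_wedge P (a # as) k vs) =
     (\<Sum>k\<le>?n. t ^ k * wedge1 (flat a) (partial_wedge P as k) vs) +
     t * (\<Sum>k\<le>?n. t ^ k * wedge1 (flat (P a)) (partial_wedge P as k) vs)"
    unfolding A[symmetric] B[symmetric] by (simp add: sum.distrib distrib_left del: sum.atMost_Suc)
  also have "\<dots> = wedge_list (map (\<lambda>a. flat (a + t *\<^sub>R P a)) (a # as)) vs"
    by (simp only: list.map wedge_list.simps IH wedge1_flat_add_scaleR wedge1_sum_right)
      (simp add: sum.distrib sum_distrib_left algebra_simps)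
  finally show ?case by simp
qed simp

section \<open>Positive definite square roots\<close>

lemma linear_sum_list: "linear f \<Longrightarrow> f (\<Sum>x\<leftarrow>xs. g x) = (\<Sum>x\<leftarrow>xs. f (g x))"
  by (induction xs) (auto simp: linear_0 linear_add)

text \<open>The maximum of the Rayleigh quotient over the unit sphere of an invariant subspace is attained
  at an eigenvector.\<close>
lemma selfadjoint_eigenvector_in_subspace:
  fixes f :: "'a::euclidean_space \<Rightarrow> 'a"
  assumes "linear f" and sa: "\<And>u v. f u \<bullet> v = u \<bullet> f v"
    and S: "subspace S" "f ` S \<subseteq> S" "S \<noteq> {0}"
  obtains v c where "v \<in> S" "norm v = 1" "f v = c *\<^sub>R v"
proof -
  interpret f: linear f by fact
  let ?K = "S \<inter> sphere 0 1"
  obtain w where w: "w \<in> S" "w \<noteq> 0"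
    using S subspace_0 by blast
  have "compact ?K"
    by (simp add: closed_Int_compact closed_subspace S(1))
  moreover have "(1 / norm w) *\<^sub>R w \<in> ?K"
    using w S(1) by (simp add: subspace_scale)
  moreover have "continuous_on ?K (\<lambda>v. f v \<bullet> v)"
    by (intro continuous_intros linear_continuous_on linear_conv_bounded_linear[THEN iffD1] \<open>linear f\<close>)
  ultimately obtain v where v: "v \<in> ?K" and max: "\<And>u. u \<in> ?K \<Longrightarrow> f u \<bullet> u \<le> f v \<bullet> v"
    using continuous_attains_sup[of ?K "\<lambda>v. f v \<bullet> v"] by blast
  define c where "c = f v \<bullet> v"
  have vv: "v \<bullet> v = 1" using v by (simp add: norm_eq_1)
  have le: "f u \<bullet> u \<le> c * (u \<bullet> u)" if "u \<in> S" for u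
  proof (cases "u = 0")
    case False
    then have "(1 / norm u) *\<^sub>R u \<in> ?K"
      using that S(1) by (simp add: subspace_scale)
    from max[OF this] have "(f u \<bullet> u) / (norm u)\<^sup>2 \<le> c"
      by (simp add: f.scaleR c_def power2_eq_square)
    then show ?thesis
      using False by (simp add: divide_le_eq power2_norm_eq_inner)
  qed simp
  have orth: "f v \<bullet> u = 0" if "u \<in> S" "u \<bullet> v = 0" for u
  proof (rule ccontr)
    assume ne: "f v \<bullet> u \<noteq> 0"
    define a b where "a = f v \<bullet> u" and "b = f u \<bullet> u - c * (u \<bullet> u)"
    have q: "2 * t * a + t\<^sup>2 * b \<le> 0" for t
    proof -
      have "v + t *\<^sub>R u \<in> S" using v that S(1) by (simp add: subspace_add subspace_scale)
      from le[OF this] show ?thesis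
        using that(2) sa[of u v]
        by (simp add: f.add f.scaleR inner_add inner_left_distrib inner_right_distrib vv a_def b_def c_def
             inner_commute algebra_simps power2_eq_square)
    qed
    have "a \<noteq> 0" using ne a_def by simp
    \<comment> \<open>The competitor \<open>v + t u\<close> must not beat the maximiser. At this
      \<open>t\<close> the linear term is \<open>2 a^2 / (|b| + 1)\<close>, while the quadratic one
      exceeds \<open>- a^2 / (|b| + 1)\<close>, whatever the sign of \<open>b\<close>.\<close>
    define t where "t = a / (\<bar>b\<bar> + 1)"
    have "2 * t * a + t\<^sup>2 * b = a\<^sup>2 / (\<bar>b\<bar> + 1) * (2 + b / (\<bar>b\<bar> + 1))"
    proof -
      have "2 * t * a = a\<^sup>2 / (\<bar>b\<bar> + 1) * 2" "t\<^sup>2 * b = a\<^sup>2 / (\<bar>b\<bar> + 1) * (b / (\<bar>b\<bar> + 1))"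
        by (simp_all add: t_def power2_eq_square)
      then show ?thesis by (simp only: distrib_left)
    qed
    moreover have "b / (\<bar>b\<bar> + 1) > -1"
      by (simp add: field_simps)
    then have "a\<^sup>2 / (\<bar>b\<bar> + 1) * (2 + b / (\<bar>b\<bar> + 1)) > 0"
      using \<open>a \<noteq> 0\<close> by (intro mult_pos_pos divide_pos_pos) auto
    ultimately show False using q[of t] by simp
  qed
  \<comment> \<open>The residual lies in \<open>S\<close> and is orthogonal to \<open>v\<close>,
    hence also to \<open>f v\<close>, and so to itself.\<close>
  have "f v - c *\<^sub>R v \<in> S"
    using v S by (auto intro!: subspace_diff subspace_scale)
  moreover have "(f v - c *\<^sub>R v) \<bullet> v = 0"
    by (simp add: inner_diff_left vv c_def)
  ultimately have "f v \<bullet> (f v - c *\<^sub>R v) = 0" "v \<bullet> (f v - c *\<^sub>R v) = 0"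
    using orth[of "f v - c *\<^sub>R v"] by (simp_all add: inner_commute)
  then have "(f v - c *\<^sub>R v) \<bullet> (f v - c *\<^sub>R v) = 0"
    by (simp add: inner_diff_left)
  then have "f v = c *\<^sub>R v" by simp
  with that v show ?thesis by auto
qed

text \<open>Take an orthonormal set of eigenvectors of maximal size. By self-adjointness its
  orthogonal complement is invariant, so if nonzero it would contribute one more
  eigenvector.\<close>

lemma selfadjoint_eigenbasis:
  fixes f :: "'a::euclidean_space \<Rightarrow> 'a"
  assumes "linear f" and sa: "\<And>u v. f u \<bullet> v = u \<bullet> f v"
  obtains B c where "finite B" "pairwise orthogonal B" "\<And>v. v \<in> B \<Longrightarrow> norm v = 1"
    "span B = UNIV" "\<And>v. v \<in> B \<Longrightarrow> f v = c v *\<^sub>R v"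
proof -
  interpret f: linear f by fact
  define good where "good B \<longleftrightarrow> pairwise orthogonal B \<and> (\<forall>v\<in>B. norm v = 1 \<and> (\<exists>c. f v = c *\<^sub>R v))" for B
  have indep: "independent B" if "good B" for B
    using that by (intro pairwise_orthogonal_independent) (auto simp: good_def)
  have "good {}" by (simp add: good_def)
  moreover have "\<forall>B. good B \<longrightarrow> card B < Suc DIM('a)"
    using indep independent_bound by (auto simp: less_Suc_eq_le)
  ultimately obtain B where B: "good B" and max: "\<And>B'. good B' \<Longrightarrow> card B' \<le> card B"
    using ex_has_greatest_nat[of good "{}" card "Suc DIM('a)"] by blast
  have fin: "finite B" using indep[OF B] independent_bound by blast
  have "span B = UNIV"
  proof (rule ccontr)
    assume "span B \<noteq> UNIV"
    let ?S = "{x. \<forall>v\<in>B. x \<bullet> v = 0}"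
    obtain a where a: "a \<noteq> 0" "\<And>x. x \<in> span B \<Longrightarrow> a \<bullet> x = 0"
      using orthogonal_to_subspace_exists_gen[of B UNIV] \<open>span B \<noteq> UNIV\<close>
      by (metis orthogonal_def span_UNIV top.not_eq_extremum)
    have "subspace ?S"
      by (auto simp: subspace_def inner_add_left)
    moreover have "f ` ?S \<subseteq> ?S"
    proof clarify
      fix x v assume "\<forall>v\<in>B. x \<bullet> v = 0" "v \<in> B"
      moreover obtain c where "f v = c *\<^sub>R v" using B \<open>v \<in> B\<close> by (auto simp: good_def)
      ultimately show "f x \<bullet> v = 0" by (simp add: sa)
    qed
    moreover have "?S \<noteq> {0}" 
      using a span_base[of _ B] by blast
    ultimately obtain v c where v: "v \<in> ?S" "norm v = 1" "f v = c *\<^sub>R v"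
      using selfadjoint_eigenvector_in_subspace[OF assms] by blast
    have "v \<notin> B" using v by force
    moreover have "good (insert v B)"
      using B v unfolding good_def by (auto simp: pairwise_insert orthogonal_def inner_commute)
    ultimately show False using max[of "insert v B"] fin by simp
  qed
  moreover obtain c where "\<And>v. v \<in> B \<Longrightarrow> f v = c v *\<^sub>R v"
    using B unfolding good_def by metis
  ultimately show ?thesis using that B fin unfolding good_def by blast
qed

lemma pos_def_op_inj: "pos_def_op A \<Longrightarrow> inj A"
  unfolding pos_def_op_def using linear_injective_0[of A] by (metis inner_zero_left less_irrefl)

lemma pos_def_op_bij: "pos_def_op A \<Longrightarrow> bij A"
  unfolding bij_def using pos_def_op_inj linear_injective_imp_surjective pos_def_op_def by blast

text \<open>The defect \<open>w = S v - sqrt c v\<close> satisfies \<open>S w = - sqrt c w\<close>,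
  which positivity allows only for \<open>w = 0\<close>. A positive root is thus determined on every
  eigenvector of its square; uniqueness and intertwining both rest on this.\<close>

lemma pos_def_op_sqrt_eigenvector:
  assumes "pos_def_op S" and "S (S v) = c *\<^sub>R v" and "c \<ge> 0"
  shows "S v = sqrt c *\<^sub>R v"
proof -
  have lin: "linear S" using assms(1) by (simp add: pos_def_op_def)
  define w where "w = S v - sqrt c *\<^sub>R v"
  have "S w = - sqrt c *\<^sub>R w"
    using assms(2,3) by (simp add: w_def linear_diff[OF lin] linear_scale[OF lin] scaleR_diff_right)
  then have "S w \<bullet> w \<le> 0" using assms(3) by (simp add: mult_nonneg_nonneg)
  then have "w = 0" using assms(1) unfolding pos_def_op_def by force
  then show ?thesis by (simp add: w_def)
qed

text \<open>Discharges the definite description. The root is built diagonally in an eigenbasis of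
  \<open>A\<close>, with eigenvalues \<open>1 / sqrt (c v)\<close>, and any other root has the same
  values on that basis.\<close>

lemma inv_sqrt:
  fixes A :: "'a::euclidean_space \<Rightarrow> 'a"
  assumes A: "pos_def_op A"
  shows "pos_def_op (inv_sqrt A)" "inv_sqrt A (inv_sqrt A x) = inv A x"
proof -
  have lin: "linear A" and sa: "\<And>u v. A u \<bullet> v = u \<bullet> A v" and pos: "\<And>v. v \<noteq> 0 \<Longrightarrow> 0 < A v \<bullet> v"
    using A by (auto simp: pos_def_op_def)
  obtain B c where fin: "finite B" and orth: "pairwise orthogonal B" and n1: "\<And>v. v \<in> B \<Longrightarrow> norm v = 1"
    and span: "span B = UNIV" and eig: "\<And>v. v \<in> B \<Longrightarrow> A v = c v *\<^sub>R v"
    using selfadjoint_eigenbasis[OF lin sa] by metis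
  have ip: "u \<bullet> v = (if u = v then 1 else 0)" if "u \<in> B" "v \<in> B" for u v
    using that orth n1[of u] by (auto simp: pairwise_def orthogonal_def norm_eq_1)
  have cpos: "c v > 0" if "v \<in> B" for v
    using pos[of v] that eig[of v] n1[of v] ip[of v v] by (cases "v = 0") auto
  have invA: "inv A v = (1 / c v) *\<^sub>R v" if "v \<in> B" for v
  proof -
    have "A ((1 / c v) *\<^sub>R v) = v"
      using cpos[OF that] eig[OF that] by (simp add: linear_scale[OF lin])
    then show ?thesis using pos_def_op_inj[OF A] by (metis inv_f_f)
  qed
  have lininv: "linear (inv A)"
    using left_inverse_linear[OF lin] pos_def_op_inj[OF A] by (simp add: inj_iff)
  define S where "S = (\<lambda>x. \<Sum>v\<in>B. (x \<bullet> v / sqrt (c v)) *\<^sub>R v)"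
  have linS: "linear S"
    unfolding S_def
    by (rule linearI) (simp_all add: inner_add_left add_divide_distrib scaleR_add_left sum.distrib scaleR_sum_right)
  have Sv: "S v = (1 / sqrt (c v)) *\<^sub>R v" if "v \<in> B" for v
  proof -
    have "S v = (\<Sum>u\<in>B. if u = v then (1 / sqrt (c v)) *\<^sub>R v else 0)"
      unfolding S_def by (rule sum.cong) (auto simp: ip that)
    then show ?thesis using fin that by simp
  qed
  have expand: "x = (\<Sum>v\<in>B. (x \<bullet> v) *\<^sub>R v)" for x
    using orthonormal_basis_expand[of B x] fin orth n1 span
    by (simp add: inner_commute)
  have "pos_def_op S"
    unfolding pos_def_op_def
  proof (intro conjI allI impI)
    show "S u \<bullet> v = u \<bullet> S v" for u v
      by (simp add: S_def inner_sum_left inner_sum_right inner_commute mult_ac)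
    fix x :: 'a assume "x \<noteq> 0"
    obtain v where v: "v \<in> B" "x \<bullet> v \<noteq> 0"
    proof (rule ccontr)
      assume "\<not> thesis"
      then have "(\<Sum>v\<in>B. (x \<bullet> v) *\<^sub>R v) = 0" using that by (intro sum.neutral) auto
      with expand[of x] \<open>x \<noteq> 0\<close> show False by simp
    qed
    have "S x \<bullet> x = (\<Sum>v\<in>B. (x \<bullet> v)\<^sup>2 / sqrt (c v))"
      by (simp add: S_def inner_sum_left inner_sum_right power2_eq_square inner_commute[of _ x])
    also have "\<dots> > 0"
    proof (rule sum_pos2[OF fin v(1)])
      show "0 < (x \<bullet> v)\<^sup>2 / sqrt (c v)" using v cpos[OF v(1)] by simp
      show "0 \<le> (x \<bullet> u)\<^sup>2 / sqrt (c u)" if "u \<in> B" for u using cpos[OF that] by simp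
    qed
    finally show "S x \<bullet> x > 0" .
  qed (rule linS)
  moreover have "S \<circ> S = inv A"
  proof (rule linear_eq_on_span[of "S \<circ> S" "inv A" B, THEN ext])
    show "(S \<circ> S) x = inv A x" if "x \<in> B" for x
      using that cpos[OF that] by (simp add: Sv invA linear_scale[OF linS])
  qed (auto simp: span lininv linS intro: linear_compose)
  moreover have "T = S" if T: "pos_def_op T \<and> T \<circ> T = inv A" for T
  proof (rule linear_eq_on_span[of T S B, THEN ext])
    show "linear T" using T by (simp add: pos_def_op_def)
    fix v assume v: "v \<in> B"
    have "T (T v) = (1 / c v) *\<^sub>R v" using T invA[OF v] by (metis comp_apply)
    then show "T v = S v"
      using pos_def_op_sqrt_eigenvector[of T v "1 / c v"] T cpos[OF v] Sv[OF v] by (simp add: real_sqrt_divide)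
  qed (auto simp: span linS)
  ultimately have "inv_sqrt A = S"
    unfolding inv_sqrt_def by (intro the_equality conjI)
  with \<open>pos_def_op S\<close> \<open>S \<circ> S = inv A\<close>
  show "pos_def_op (inv_sqrt A)" "inv_sqrt A (inv_sqrt A x) = inv A x" by (metis comp_apply)+
qed

lemma inv_sqrt_inv_sqrt_apply:
  assumes "pos_def_op A" shows "A (inv_sqrt A (inv_sqrt A x)) = x" "inv_sqrt A (inv_sqrt A (A x)) = x"
  using pos_def_op_bij[OF assms] by (simp_all add: inv_sqrt(2)[OF assms] bij_is_surj surj_f_inv_f bij_is_inj inv_f_f)

text \<open>It suffices to check this on an eigenbasis of \<open>A\<close>, where both sides are computed by
  pos_def_op_sqrt_eigenvector.\<close>
lemma inv_sqrt_intertwine: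
  fixes A :: "'a::euclidean_space \<Rightarrow> 'a" and B :: "'b::euclidean_space \<Rightarrow> 'b"
  assumes A: "pos_def_op A" and B: "pos_def_op B" and "linear D" and comm: "\<And>x. D (A x) = B (D x)"
  shows "D (inv_sqrt A x) = inv_sqrt B (D x)"
proof -
  have lin: "linear A" and sa: "\<And>u v. A u \<bullet> v = u \<bullet> A v" and pos: "\<And>v. v \<noteq> 0 \<Longrightarrow> 0 < A v \<bullet> v"
    using A by (auto simp: pos_def_op_def)
  have linB: "linear B" using B by (auto simp: pos_def_op_def)
  have lA: "linear (inv_sqrt A)" and lB: "linear (inv_sqrt B)"
    using inv_sqrt(1)[OF A] inv_sqrt(1)[OF B] by (auto simp: pos_def_op_def)
  obtain E c where n1: "\<And>v. v \<in> E \<Longrightarrow> norm v = 1"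
    and span: "span E = UNIV" and eig: "\<And>v. v \<in> E \<Longrightarrow> A v = c v *\<^sub>R v"
    using selfadjoint_eigenbasis[OF lin sa] by metis
  show ?thesis
  proof (rule linear_eq_on_span[of "\<lambda>x. D (inv_sqrt A x)" "\<lambda>x. inv_sqrt B (D x)" E])
    fix v assume v: "v \<in> E"
    have "v \<noteq> 0" using n1[OF v] by auto
    then have c: "c v > 0"
      using pos[of v] eig[OF v] by simp (metis inner_ge_zero not_less zero_less_mult_iff)
    have "inv_sqrt A (inv_sqrt A (A v)) = v" "inv_sqrt B (inv_sqrt B (B (D v))) = D v"
      using inv_sqrt_inv_sqrt_apply A B by blast+
    then have "c v *\<^sub>R inv_sqrt A (inv_sqrt A v) = v" "c v *\<^sub>R inv_sqrt B (inv_sqrt B (D v)) = D v"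
      by (simp_all add: comm[symmetric] eig[OF v] linear_scale[OF lA] linear_scale[OF lB] linear_scale[OF \<open>linear D\<close>])
    then have "inv_sqrt A (inv_sqrt A v) = (1 / c v) *\<^sub>R v" "inv_sqrt B (inv_sqrt B (D v)) = (1 / c v) *\<^sub>R D v"
      using c by (metis divideR_right divide_inverse less_irrefl mult_1 scaleR_one)+
    then have "inv_sqrt A v = sqrt (1 / c v) *\<^sub>R v" "inv_sqrt B (D v) = sqrt (1 / c v) *\<^sub>R D v"
      using pos_def_op_sqrt_eigenvector inv_sqrt(1) A B c by (metis divide_nonneg_pos zero_le_one)+
    then show "D (inv_sqrt A v) = inv_sqrt B (D v)"
      by (simp add: linear_scale[OF \<open>linear D\<close>])
  qed (use span \<open>linear D\<close> lA lB in \<open>auto intro: linear_compose[unfolded o_def]\<close>)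
qed

lemma G_op_pos_def: "linear D \<Longrightarrow> pos_def_op (G_op D)"
  unfolding pos_def_op_def G_op_def
  by (auto simp: inner_add adjoint_works adjoint_clauses inner_commute linear_add linear_scale adjoint_linear
      scaleR_add_right add_pos_nonneg intro!: linearI)

lemma H_op_pos_def: "linear D \<Longrightarrow> pos_def_op (H_op D)"
  using G_op_pos_def[of "adjoint D"] by (simp add: G_op_def H_op_def adjoint_linear adjoint_adjoint)

lemma J_op_graph:
  fixes D :: "'a::euclidean_space \<Rightarrow> 'b::euclidean_space"
  assumes D: "linear D"
  shows "J_op D (u, D u) = (- adjoint D (D u), D u)"
proof -
  note G = G_op_pos_def[OF D] and H = H_op_pos_def[OF D]
  have "bij (inv_sqrt (G_op D))" using pos_def_op_bij inv_sqrt(1) G by blast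
  then obtain v where v: "u = inv_sqrt (G_op D) v" and "inj (inv_sqrt (G_op D))"
    by (metis bij_pointE bij_is_inj)
  have "inj (L_tan D)"
    using \<open>inj (inv_sqrt (G_op D))\<close> by (auto simp: inj_def L_tan_def)
  moreover have "(u, D u) = L_tan D v" by (simp add: L_tan_def v)
  ultimately have "inv (L_tan D) (u, D u) = v" by (metis inv_f_f)
  \<comment> \<open>The commutation needed is \<open>D G = H D\<close>, both sides being
    \<open>D + D D^* D\<close>. After this step no square root remains.\<close>
  moreover have "inv_sqrt (H_op D) (D v) = D u"
    unfolding v using D by (intro inv_sqrt_intertwine[symmetric] G H) (auto simp: G_op_def H_op_def linear_add)
  ultimately show ?thesis by (simp add: J_op_def L_nor_def)
qed

section \<open>Alternating functions of the rows of a matrix\<close>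

text \<open>Induction over row operations, for the stronger claim
  \<open>f (A ** B) = det A * f B\<close> with \<open>B\<close> arbitrary: a column swap in
  \<open>A\<close> acts on the product as a row swap in \<open>B\<close>, so \<open>B\<close> cannot
  stay fixed. At the end \<open>B = mat 1\<close>.\<close>

lemma row_linear_alternating_eq_det:
  fixes f :: "real^'n^'n \<Rightarrow> real"
  assumes add: "\<And>A i x c y. f (\<chi> j. if j = i then x + c *\<^sub>R y else A $ j) =
      f (\<chi> j. if j = i then x else A $ j) + c * f (\<chi> j. if j = i then y else A $ j)"
    and alt: "\<And>A i j. i \<noteq> j \<Longrightarrow> A $ i = A $ j \<Longrightarrow> f A = 0"
  shows "f A = det A * f (mat 1)"
proof -
  have row0: "f A = 0" if "A $ i = 0" for A i
  proof -
    have "A = (\<chi> j. if j = i then 0 else A $ j)"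
      using that by (simp add: vec_eq_iff)
    moreover have "f (\<chi> j. if j = i then 0 else A $ j) = 0"
      using add[of i 0 1 0 A] by (simp only: scaleR_zero_right add_0_right)
    ultimately show ?thesis by simp
  qed
  have rowop: "f (\<chi> j. if j = m then A $ m + c *\<^sub>R A $ n else A $ j) = f A" if "m \<noteq> n" for A m n c
  proof -
    have "f (\<chi> j. if j = m then A $ n else A $ j) = 0"
      using that by (intro alt[of m n]) auto
    moreover have "(\<chi> j. if j = m then A $ m else A $ j) = A"
      by (simp add: vec_eq_iff)
    ultimately show ?thesis by (simp add: add)
  qed
  have swap: "f (\<chi> j. A $ Transposition.transpose m n j) = - f A" if "m \<noteq> n" for A m n
  proof -
    define g where "g x y = f (\<chi> j. if j = m then x else if j = n then y else A $ j)" for x y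
    have g1: "g (x + c *\<^sub>R x') y = g x y + c * g x' y" for x x' y c
      using add[of m x c x' "\<chi> j. if j = n then y else A $ j"]
      by (simp add: g_def cong: if_cong)
    have *: "(\<chi> j. if j = m then x else if j = n then y else A $ j) =
        (\<chi> j. if j = n then y else (\<chi> j. if j = m then x else A $ j) $ j)" for x y
      using that by (auto simp: vec_eq_iff)
    have g2: "g x (y + c *\<^sub>R y') = g x y + c * g x y'" for x y y' c
      unfolding g_def * by (rule add)
    have g0: "g x x = 0" for x
      unfolding g_def using that by (intro alt[of m n]) auto
    \<comment> \<open>Polarisation: the alternating \<open>g\<close> is expanded at the sum of the
      two rows.\<close>
    have "g (A $ m + 1 *\<^sub>R A $ n) (A $ m + 1 *\<^sub>R A $ n) = 0" by (rule g0)
    then have "g (A $ n) (A $ m) = - g (A $ m) (A $ n)"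
      unfolding g1 g2 by (simp add: g0)
    moreover have "(\<chi> j. if j = m then A $ m else if j = n then A $ n else A $ j) = A"
      "(\<chi> j. if j = m then A $ n else if j = n then A $ m else A $ j) = (\<chi> j. A $ Transposition.transpose m n j)"
      by (auto simp: vec_eq_iff Transposition.transpose_def)
    ultimately show ?thesis by (simp add: g_def)
  qed
  have diag: "f (\<chi> j. if j \<in> K then c j *\<^sub>R A $ j else A $ j) = prod c K * f A" if "finite K" for A K c
    using that
  proof (induction K)
    case (insert i K)
    have "(\<chi> j. if j \<in> insert i K then c j *\<^sub>R A $ j else A $ j) =
        (\<chi> j. if j = i then 0 + c i *\<^sub>R A $ i else (\<chi> j. if j \<in> K then c j *\<^sub>R A $ j else A $ j) $ j)"
      by (auto simp: vec_eq_iff)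
    moreover have "f (\<chi> j. if j = i then 0 else (\<chi> j. if j \<in> K then c j *\<^sub>R A $ j else A $ j) $ j) = 0"
      by (rule row0[of _ i]) simp
    moreover have "(\<chi> j. if j = i then A $ i else (\<chi> j. if j \<in> K then c j *\<^sub>R A $ j else A $ j) $ j) =
       (\<chi> j. if j \<in> K then c j *\<^sub>R A $ j else A $ j)"
      using insert by (auto simp: vec_eq_iff)
    ultimately show ?case
      using insert by (simp only: add) simp
  qed simp
  have "\<forall>B. f (A ** B) = det A * f B"
  proof (induction A rule: induct_matrix_row_operations)
    case (1 A i)
    then have "(A ** B) $ i = 0" for B
      by (simp add: vec_eq_iff matrix_matrix_mult_def row_def)
    then have "f (A ** B) = 0" for B by (rule row0)
    then show ?case using 1 by (simp add: det_zero_row(2))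
  next
    case (2 A)
    have eq: "A ** B = (\<chi> j. A $ j $ j *\<^sub>R B $ j)" for B
    proof -
      have "(\<Sum>k\<in>UNIV. A $ i $ k * B $ k $ j) = (\<Sum>k\<in>UNIV. if k = i then A $ i $ i * B $ i $ j else 0)" for i j
        by (rule sum.cong) (auto simp: 2)
      then show ?thesis by (simp add: vec_eq_iff matrix_matrix_mult_def)
    qed
    show ?case
      unfolding eq using diag[of UNIV "\<lambda>j. A $ j $ j"] by (simp add: det_diagonal[OF 2])
  next
    case (3 A m n)
    have eq: "(\<chi> i j. A $ i $ Transposition.transpose m n j) ** B = A ** (\<chi> j. B $ Transposition.transpose m n j)" for B
      unfolding vec_eq_iff matrix_matrix_mult_def
      by (auto intro!: sum.reindex_bij_witness[where i = "Transposition.transpose m n" and j = "Transposition.transpose m n"])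
    have "det (\<chi> i j. A $ i $ Transposition.transpose m n j) = - det A"
    proof -
      have "det (\<chi> i j. A $ i $ Transposition.transpose m n j) = of_int (sign (Transposition.transpose m n)) * det A"
        by (rule det_permute_columns) (rule permutes_swap_id, auto)
      then show ?thesis using 3 by (simp add: sign_swap_id)
    qed
    then show ?case
      unfolding eq using 3 by (simp add: swap)
  next
    case (4 A m n c)
    have eq: "(\<chi> i. if i = m then row m A + c *\<^sub>R row n A else row i A) ** B =
       (\<chi> j. if j = m then (A ** B) $ m + c *\<^sub>R (A ** B) $ n else (A ** B) $ j)" for B
      by (auto simp: vec_eq_iff matrix_matrix_mult_def row_def sum.distrib sum_distrib_left algebra_simps)
    show ?case
      unfolding eq using 4 det_row_operation[of m n A c, unfolded scalar_mult_eq_scaleR]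
      by (simp add: rowop)
  qed
  from this[rule_format, of "mat 1"] show ?thesis by simp
qed

abbreviation coords :: "'n::{finite,linorder} list" where
  "coords \<equiv> sorted_list_of_set UNIV"

lemma wedge_list_map_update_sum:
  assumes "distinct xs" "k \<in> set xs"
  shows "wedge_list (map (\<alpha>(k := (\<lambda>v. \<Sum>i\<in>I. c i * \<beta> i v))) xs) vs =
    (\<Sum>i\<in>I. c i * wedge_list (map (\<alpha>(k := \<beta> i)) xs) vs)"
proof -
  obtain p where p: "p < length xs" "xs ! p = k" using assms by (auto simp: in_set_conv_nth)
  have "map (\<alpha>(k := \<gamma>)) xs = (map \<alpha> xs)[p := \<gamma>]" for \<gamma>
    using p assms by (auto intro!: nth_equalityI simp: nth_list_update nth_eq_iff_index_eq)
  then show ?thesis using p by (simp add: wedge_list_update_sum)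
qed

text \<open>With \<open>g = fst\<close> this serves twice: it relates the orientation of a frame to
  a determinant, and it turns \<open>exp(-Psi) vol\<close> into a multiple of dx.\<close>

lemma wedge_list_rows_eq_det:
  fixes A :: "((real, 'n::{finite,linorder}) vec, 'n) vec" and g :: "'v \<Rightarrow> (real, 'n) vec"
  shows "wedge_list (map (\<lambda>i v. A $ i \<bullet> g v) coords) vs =
    det A * wedge_list (map (\<lambda>i v. g v $ i) coords) vs"
proof -
  define f :: "((real, 'n) vec, 'n) vec \<Rightarrow> real"
    where "f A = wedge_list (map (\<lambda>i v. A $ i \<bullet> g v) coords) vs" for A
  have upd: "(\<lambda>j v. (\<chi> j. if j = i then x else A $ j) $ j \<bullet> g v) = (\<lambda>j v. A $ j \<bullet> g v)(i := (\<lambda>v. x \<bullet> g v))"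
    for x i and A :: "((real, 'n) vec, 'n) vec" by (auto simp: fun_eq_iff)
  have "f A = det A * f (mat 1 :: ((real, 'n) vec, 'n) vec)"
  proof (rule row_linear_alternating_eq_det)
    fix A :: "((real, 'n) vec, 'n) vec" and i x c y
    have 1: "(\<lambda>v. (x + c *\<^sub>R y) \<bullet> g v) = (\<lambda>v. \<Sum>k\<in>UNIV. (if k then 1 else c) * ((if k then x else y) \<bullet> g v))"
      by (simp add: UNIV_bool inner_add_left add.commute)
    show "f (\<chi> j. if j = i then x + c *\<^sub>R y else A $ j) =
      f (\<chi> j. if j = i then x else A $ j) + c * f (\<chi> j. if j = i then y else A $ j)"
      unfolding f_def upd 1 by (subst wedge_list_map_update_sum) (auto simp: UNIV_bool)
  next
    fix A :: "((real, 'n) vec, 'n) vec" and i j assume "i \<noteq> j" "A $ i = A $ j"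
    then have "\<not> inj (\<lambda>i v. A $ i \<bullet> g v)"
      by (metis injD)
    then have "\<not> distinct (map (\<lambda>i v. A $ i \<bullet> g v) coords)"
      by (simp add: distinct_map)
    then show "f A = 0" by (simp add: f_def wedge_list_not_distinct)
  qed
  moreover have "mat 1 $ i \<bullet> v = v $ i" for i and v :: "(real, 'n) vec"
    by (simp add: mat_def inner_vec_def if_distrib if_distribR cong: if_cong)
  ultimately show ?thesis by (simp add: f_def)
qed

lemma std_vol_map: "std_vol (map g vs) = wedge_list (map (\<lambda>i v. g v $ i) coords) vs"
  unfolding std_vol_def by (simp add: wedge_list_compose[symmetric] o_def)

text \<open>Reindexes a frame by the coordinate type, so that its vectors can form the rows of a
  square matrix.\<close>

lemma list_indexed_by_coords:
  fixes es :: "'v list"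
  assumes "length es = CARD('n::{finite,linorder})"
  obtains h :: "'n::{finite,linorder} \<Rightarrow> 'v" where "es = map h coords"
proof -
  have d: "distinct (coords :: 'n list)" and l: "length (coords :: 'n list) = length es"
    using assms by simp_all
  have "es = map (\<lambda>i. the (map_of (zip coords es) i)) (coords :: 'n list)"
    using l d by (auto intro!: nth_equalityI simp: map_of_zip_nth)
  then show ?thesis by (rule that)
qed

section \<open>Orthonormal frames of a graph\<close>

lemma orthonormal_basis_of_exists:
  fixes T :: "'v::euclidean_space set"
  assumes "subspace T"
  obtains es where "orthonormal_basis_of T es"
proof -
  obtain B where B: "B \<subseteq> T" "pairwise orthogonal B" "\<And>x. x \<in> B \<Longrightarrow> norm x = 1"
    "independent B" "span B = T"
    using orthonormal_basis_subspace[OF assms] by metis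
  then obtain es where es: "set es = B" "distinct es"
    using finite_distinct_list independent_imp_finite by blast
  have "es ! i \<bullet> es ! j = (if i = j then 1 else 0)" if "i < length es" "j < length es" for i j
    using that B(2) B(3)[of "es ! i"] es by (auto simp: pairwise_def orthogonal_def nth_eq_iff_index_eq norm_eq_1)
  then have "orthonormal_basis_of T es" using B(5) es by (simp add: orthonormal_basis_of_def)
  then show ?thesis by (rule that)
qed

context
  fixes T :: "'v::euclidean_space set" and es
  assumes onb: "orthonormal_basis_of T es"
begin

lemma orthonormal_basis_of_mem: "e \<in> set es \<Longrightarrow> e \<in> T"
  using onb span_base by (auto simp: orthonormal_basis_of_def)

lemma orthonormal_basis_of_subspace: "subspace T"
  using onb by (auto simp: orthonormal_basis_of_def)

lemma orthonormal_basis_of_inner: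
  "e \<in> set es \<Longrightarrow> e' \<in> set es \<Longrightarrow> e \<bullet> e' = (if e = e' then 1 else 0)"
  using onb by (auto simp: orthonormal_basis_of_def in_set_conv_nth) 

lemma orthonormal_basis_of_distinct: "distinct es"
  using onb unfolding orthonormal_basis_of_def distinct_conv_nth by (metis zero_neq_one)

lemma orthonormal_basis_of_length: "length es = dim T"
proof -
  have "independent (set es)"
    using orthonormal_basis_of_inner
    by (intro pairwise_orthogonal_independent) (auto simp: pairwise_def orthogonal_def, metis inner_zero_left zero_neq_one)
  then have "dim (span (set es)) = card (set es)" by (rule dim_span_eq_card_independent)
  then show ?thesis
    using onb distinct_card[OF orthonormal_basis_of_distinct] by (auto simp: orthonormal_basis_of_def)
qed

lemma sum_list_inner_orthonormal_basis:
  fixes f :: "'v \<Rightarrow> 'c::real_vector"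
  assumes "e \<in> set es"
  shows "(\<Sum>e'\<leftarrow>es. (e' \<bullet> e) *\<^sub>R f e') = f e"
proof -
  have "(\<Sum>e'\<leftarrow>es. (e' \<bullet> e) *\<^sub>R f e') = (\<Sum>e'\<in>set es. (e' \<bullet> e) *\<^sub>R f e')"
    using orthonormal_basis_of_distinct by (simp add: sum_list_distinct_conv_sum_set)
  also have "\<dots> = (\<Sum>e'\<in>set es. if e' = e then f e else 0)"
    using assms by (intro sum.cong) (auto simp: orthonormal_basis_of_inner)
  finally show ?thesis using assms by simp
qed

lemma orthonormal_basis_of_projection:
  assumes "x \<in> T"
  shows "(y - (\<Sum>e\<leftarrow>es. (e \<bullet> y) *\<^sub>R e)) \<bullet> x = 0"
proof -
  let ?p = "\<Sum>e\<leftarrow>es. (e \<bullet> y) *\<^sub>R e"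
  have "?p \<bullet> e = y \<bullet> e" if "e \<in> set es" for e
  proof -
    have "?p \<bullet> e = (\<Sum>e'\<leftarrow>es. (e' \<bullet> y) * (e' \<bullet> e))"
      using linear_sum_list[of "\<lambda>p. p \<bullet> e" "\<lambda>e. (e \<bullet> y) *\<^sub>R e" es] by (simp add: linear_iff inner_add_left)
    also have "\<dots> = (\<Sum>e'\<leftarrow>es. (e' \<bullet> e) *\<^sub>R (e' \<bullet> y))" by (simp add: mult.commute)
    finally show ?thesis using sum_list_inner_orthonormal_basis[OF that, of "\<lambda>e. e \<bullet> y"] by (simp add: inner_commute)
  qed
  then have "orthogonal (y - ?p) e" if "e \<in> set es" for e
    using that by (simp add: orthogonal_def inner_diff_left)
  then show ?thesis
    using orthogonal_to_span[of x "set es"] assms onb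
    by (simp add: orthonormal_basis_of_def orthogonal_def)
qed

end

section \<open>Frames of the tangent space of a graph\<close>

lemma subspace_graph: "linear D \<Longrightarrow> subspace (range (\<lambda>u. (u, D u)))"
  by (intro linear_subspace_image subspace_UNIV) (auto intro!: linearI simp: linear_add linear_scale)

lemma dim_graph:
  fixes D :: "'a::euclidean_space \<Rightarrow> 'b::euclidean_space"
  assumes "linear D" shows "dim (range (\<lambda>u. (u, D u))) = DIM('a)"
proof -
  have "linear (\<lambda>u. (u, D u))" using assms by (auto intro!: linearI simp: linear_add linear_scale)
  moreover have "inj (\<lambda>u. (u, D u))" by (auto simp: inj_def)
  ultimately show ?thesis using dim_image_eq[of "\<lambda>u. (u, D u)" UNIV] by simp
qed

lemma G_op_inner: "linear D \<Longrightarrow> G_op D u \<bullet> v = u \<bullet> v + D u \<bullet> D v"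
  by (simp add: G_op_def inner_add_left adjoint_clauses)

lemma G_op_bij: "linear D \<Longrightarrow> bij (G_op D)"
  using pos_def_op_bij G_op_pos_def by blast

context
  fixes D :: "'a::euclidean_space \<Rightarrow> 'b::euclidean_space" and es
  assumes lin: "linear D" and onb: "orthonormal_basis_of (range (\<lambda>u. (u, D u))) es"
begin

lemma graph_frame_snd: "e \<in> set es \<Longrightarrow> snd e = D (fst e)"
  using orthonormal_basis_of_mem[OF onb, of e] by auto

text \<open>The tangential projection of \<open>(w, 0)\<close> is \<open>(s, D s)\<close>, with
  \<open>s\<close> the frame sum; orthogonality of the remainder to all \<open>(v, D v)\<close>
  reads \<open>G s = w\<close>. Through this identity frame sums become contractions with the
  inverse metric, both for Theta and for the mean curvature.\<close>

lemma graph_frame_sum: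
  "G_op D (\<Sum>e\<leftarrow>es. (fst e \<bullet> w) *\<^sub>R fst e) = w"
proof -
  let ?s = "\<Sum>e\<leftarrow>es. (fst e \<bullet> w) *\<^sub>R fst e"
  have "(\<Sum>e\<leftarrow>es. (e \<bullet> (w, 0)) *\<^sub>R e) = (\<Sum>e\<leftarrow>es. (fst e \<bullet> w) *\<^sub>R (fst e, D (fst e)))"
    by (intro arg_cong[where f = sum_list] map_cong refl) (simp add: prod_eq_iff graph_frame_snd inner_prod_def)
  also have "\<dots> = (?s, D ?s)"
  proof -
    have "linear (\<lambda>u. (u, D u))" using lin by (auto intro!: linearI simp: linear_add linear_scale)
    from linear_sum_list[OF this, of "\<lambda>e. (fst e \<bullet> w) *\<^sub>R fst e" es] show ?thesis
      by (simp add: linear_scale[OF lin])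
  qed
  finally have p: "(\<Sum>e\<leftarrow>es. (e \<bullet> (w, 0)) *\<^sub>R e) = (?s, D ?s)" .
  have "(w - G_op D ?s) \<bullet> v = 0" for v
    using orthonormal_basis_of_projection[OF onb, of "(v, D v)" "(w, 0)"]
    unfolding p by (simp add: inner_diff_left G_op_inner[OF lin])
  from this[of "w - G_op D ?s"] show ?thesis by simp
qed

lemma extend_frame_J_op:
  assumes "e \<in> set es"
  shows "extend_frame (J_op D) es e = J_op D e" "extend_frame (J_op D) es (J_op D e) = 0"
    "e - J_op D e = (G_op D (fst e), 0)"
proof -
  show "extend_frame (J_op D) es e = J_op D e"
    unfolding extend_frame_def by (rule sum_list_inner_orthonormal_basis[OF onb assms])
  have J: "J_op D e = (- adjoint D (D (fst e)), D (fst e))" if "e \<in> set es" for e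
    using J_op_graph[OF lin, of "fst e"] by (simp flip: graph_frame_snd[OF that])
  \<comment> \<open>\<open>J_op D e\<close> is normal: by adjointness its two components contribute
    opposite terms.\<close>
  have "e' \<bullet> J_op D e = 0" if "e' \<in> set es" for e'
    by (simp add: J[OF assms] inner_prod_def graph_frame_snd[OF that] adjoint_clauses[OF lin])
  then show "extend_frame (J_op D) es (J_op D e) = 0"
    by (simp add: extend_frame_def cong: map_cong)
  show "e - J_op D e = (G_op D (fst e), 0)"
    by (simp add: J[OF assms] prod_eq_iff graph_frame_snd[OF assms] G_op_def)
qed

text \<open>The frame sum first projects \<open>(w, 0)\<close> to the tangent vector
  \<open>(s, D s)\<close> and then applies J, whose value there is known without square
  roots.\<close>

lemma extend_frame_horizontal:
  assumes "G_op D s = w"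
  shows "extend_frame (J_op D) es (w, 0) = (- adjoint D (D s), D s)"
proof -
  have s: "(\<Sum>e\<leftarrow>es. (fst e \<bullet> w) *\<^sub>R fst e) = s"
    using graph_frame_sum[of w] assms G_op_bij[OF lin] by (metis bij_is_inj inj_eq)
  have "extend_frame (J_op D) es (w, 0) = (\<Sum>e\<leftarrow>es. (\<lambda>u. (- adjoint D (D u), D u)) ((fst e \<bullet> w) *\<^sub>R fst e))"
    unfolding extend_frame_def
  proof (intro arg_cong[where f = sum_list] map_cong refl)
    fix e assume e: "e \<in> set es"
    have "e \<bullet> (w, 0) = fst e \<bullet> w" by (cases e) simp
    moreover have "J_op D e = (- adjoint D (D (fst e)), D (fst e))"
      using J_op_graph[OF lin, of "fst e"] by (simp flip: graph_frame_snd[OF e])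
    ultimately show "(e \<bullet> (w, 0)) *\<^sub>R J_op D e = (- adjoint D (D ((fst e \<bullet> w) *\<^sub>R fst e)), D ((fst e \<bullet> w) *\<^sub>R fst e))"
      by (simp add: linear_scale[OF lin] linear_scale[OF adjoint_linear[OF lin]])
  qed
  also have "\<dots> = (- adjoint D (D s), D s)"
    by (subst linear_sum_list[symmetric])
      (auto intro!: linearI simp: s linear_add[OF lin] linear_scale[OF lin] linear_add[OF adjoint_linear[OF lin]] linear_scale[OF adjoint_linear[OF lin]])
  finally show ?thesis .
qed

end

text \<open>With \<open>W(t) = \<Sum>\<^sub>k t\<^sup>k W\<^sub>k\<close> the exterior product of the covectors \<open>e + t J e\<close>, the derivation
  property gives \<open>\<Psi>\<^sup>k vol = k! W\<^sub>k\<close>, so that \<open>\<Theta> = W(-1) + \<Psi> W(-1)\<close>.\<close>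
lemma alternating_sum_replace_deriv:
  fixes J :: "'v::real_inner \<Rightarrow> 'v"
  assumes P: "\<And>e. e \<in> set es \<Longrightarrow> extend_frame J es e = J e"
    and PP: "\<And>e. e \<in> set es \<Longrightarrow> extend_frame J es (J e) = 0"
  defines "S \<equiv> wedge_list (map (\<lambda>e. flat (e - J e)) es)"
  defines "\<Psi> \<equiv> (\<lambda>l. (replace_deriv J es ^^ l) (wedge_list (map flat es)))"
  shows "\<Psi> 0 vs - (\<Sum>\<^sub>\<infinity>l\<in>{1..}. (-1) ^ l * ((real l - 1) / fact l) * \<Psi> l vs) =
     S vs + replace_deriv J es S vs"
proof -
  let ?W = "partial_wedge J es" and ?n = "length es"
  have d: "replace_deriv J es (?W k) = (\<lambda>vs. real (Suc k) * ?W (Suc k) vs)" for k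
    using replace_deriv_partial_wedge[OF P PP] by blast
  have \<Psi>: "\<Psi> l = (\<lambda>vs. fact l * ?W l vs)" for l
  proof (induction l)
    case 0
    then show ?case by (simp add: \<Psi>_def partial_wedge_0)
  next
    case (Suc l)
    have "\<Psi> (Suc l) = replace_deriv J es (\<Psi> l)" by (simp add: \<Psi>_def)
    also have "\<dots> = (\<lambda>vs. fact l * replace_deriv J es (?W l) vs)"
      unfolding Suc by (intro ext replace_deriv_scale)
    finally show ?case by (simp add: d mult_ac)
  qed
  have S: "S = (\<lambda>vs. \<Sum>k\<le>?n. (-1) ^ k * ?W k vs)"
    using sum_partial_wedge[of "-1" J es] by (simp add: S_def fun_eq_iff)
  have "replace_deriv J es S vs = (\<Sum>k\<le>?n. (-1) ^ k * (real (Suc k) * ?W (Suc k) vs))"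
    unfolding S by (simp add: replace_deriv_sum d)
  also have "\<dots> = (\<Sum>k\<in>{1..Suc ?n}. - ((-1) ^ k * real k * ?W k vs))"
    by (rule sum.reindex_bij_witness[where j = Suc and i = "\<lambda>k. k - 1"]) auto
  \<comment> \<open>The term \<open>k = Suc ?n\<close> drops out, having more replacements than
    factors.\<close>
  also have "\<dots> = - (\<Sum>k\<in>{1..?n}. (-1) ^ k * real k * ?W k vs)"
    by (simp add: sum_negf partial_wedge_beyond)
  finally have rS: "replace_deriv J es S vs = - (\<Sum>k\<in>{1..?n}. (-1) ^ k * real k * ?W k vs)" .
  have "(\<Sum>\<^sub>\<infinity>l\<in>{1..}. (-1) ^ l * ((real l - 1) / fact l) * \<Psi> l vs) =
      (\<Sum>\<^sub>\<infinity>l\<in>{1..?n}. (-1) ^ l * ((real l - 1) / fact l) * \<Psi> l vs)"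
    by (rule infsum_cong_neutral) (auto simp: \<Psi> partial_wedge_beyond)
  \<comment> \<open>The factorials cancel and \<open>l - 1\<close> is split: the part with
    \<open>l\<close> is \<open>- replace_deriv J es S\<close>, the part with 1 completes
    \<open>\<Psi> 0\<close> to \<open>S\<close>.\<close>
  also have "\<dots> = (\<Sum>l\<in>{1..?n}. (-1) ^ l * real l * ?W l vs) - (\<Sum>l\<in>{1..?n}. (-1) ^ l * ?W l vs)"
    by (simp add: \<Psi> sum_subtractf[symmetric]) (simp add: algebra_simps)
  finally have "\<Psi> 0 vs - (\<Sum>\<^sub>\<infinity>l\<in>{1..}. (-1) ^ l * ((real l - 1) / fact l) * \<Psi> l vs) =
     \<Psi> 0 vs + (\<Sum>l\<in>{1..?n}. (-1) ^ l * ?W l vs) + replace_deriv J es S vs"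
    by (simp add: rS)
  also have "\<Psi> 0 vs + (\<Sum>l\<in>{1..?n}. (-1) ^ l * ?W l vs) = S vs"
    unfolding S atMost_atLeast0 by (simp add: sum.atLeast_Suc_atMost \<Psi>)
  finally show ?thesis .
qed

section \<open>An explicit formula for \<open>\<Theta>(F)\<close>\<close>

lemma matrix_mult_matrix_inv:
  fixes M :: "real^'n^'n"
  assumes "invertible M"
  shows "M ** matrix_inv M = mat 1"
  using someI_ex[of "\<lambda>B. M ** B = mat 1 \<and> B ** M = mat 1"] assms
  by (simp add: invertible_def matrix_inv_def)

context
  fixes D :: "real^'n \<Rightarrow> real^'m"
  assumes lin: "linear D"
begin

lemma G_op_linear: "linear (G_op D)"
  using G_op_pos_def[OF lin] by (simp add: pos_def_op_def)

lemma G_op_matrix: "matrix (G_op D) *v v = G_op D v"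
  using matrix_vector_mul(2)[OF G_op_linear] by (rule fun_cong)

lemma transpose_matrix_G_op: "transpose (matrix (G_op D)) = matrix (G_op D)"
proof -
  have "adjoint (G_op D) = G_op D"
    using G_op_pos_def[OF lin] by (intro adjoint_unique) (simp add: pos_def_op_def)
  then show ?thesis using matrix_adjoint[OF G_op_linear] by simp
qed

lemma invertible_matrix_G_op: "invertible (matrix (G_op D))"
  using G_op_bij[OF lin] G_op_linear
  by (metis bij_is_inj matrix_left_invertible_injective G_op_matrix invertible_left_inverse ext)

lemma G_op_matrix_inv: "G_op D (matrix_inv (matrix (G_op D)) *v w) = w"
  using matrix_mult_matrix_inv[OF invertible_matrix_G_op]
  by (simp add: G_op_matrix[symmetric] matrix_vector_mul_assoc)

end

context
  fixes D :: "(real, 'n::{finite,linorder}) vec \<Rightarrow> (real, 'm::finite) vec"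
    and es and h :: "'n \<Rightarrow> (real, 'n) vec \<times> (real, 'm) vec" and A :: "((real, 'n) vec, 'n) vec"
  assumes lin: "linear D" and onb: "orthonormal_basis_of (range (\<lambda>u. (u, D u))) es"
    and h: "es = map h coords"
  defines "A \<equiv> \<chi> i. G_op D (fst (h i))"
begin

lemma frame_inner: "h i \<bullet> h j = (if i = j then 1 else 0)"
proof -
  obtain p q where "p < length (coords :: 'n list)" "coords ! p = i" "q < length (coords :: 'n list)" "coords ! q = j"
    by (metis UNIV_I finite in_set_conv_nth set_sorted_list_of_set)
  moreover from this have "p = q \<longleftrightarrow> i = j"
    using nth_eq_iff_index_eq[of "coords :: 'n list"] by auto
  moreover have "h (coords ! p) \<bullet> h (coords ! q) = (if p = q then 1 else 0)"
  proof -
    have "\<forall>i<CARD('n). \<forall>j<CARD('n). h (coords ! i) \<bullet> h (coords ! j) = (if i = j then 1 else 0)"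
      using onb by (simp add: orthonormal_basis_of_def h)
    from this[rule_format, of p q] show ?thesis using calculation by simp
  qed
  ultimately show ?thesis by simp
qed

lemma frame_snd: "snd (h i) = D (fst (h i))"
  by (rule graph_frame_snd[OF lin onb]) (simp add: h)

text \<open>\<open>G_op D\<close> is the induced metric in the coordinates x, so it carries the
  projected frame to its dual basis.\<close>

lemma frame_dual: "A $ i \<bullet> fst (h j) = (if i = j then 1 else 0)"
  using frame_inner[of i j] by (simp add: A_def G_op_inner[OF lin] inner_prod_def frame_snd)

text \<open>The rows of \<open>A\<close>, as horizontal covectors, are dual to the frame.
  Consequently a positively oriented frame has \<open>det A > 0\<close>, the only use made of
  orientation.\<close>

lemma det_frame_mult_std_vol: "det A * std_vol (map fst es) = 1"
proof -
  have "wedge_list (map (\<lambda>i v. A $ i \<bullet> fst v) coords) es = 1"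
    by (rule wedge_list_dual) (auto simp: h frame_dual nth_eq_iff_index_eq)
  then show ?thesis by (simp add: wedge_list_rows_eq_det std_vol_map)
qed

text \<open>With \<open>V\<close> the matrix of projected frame vectors, \<open>A = V M\<close> and
  duality gives \<open>A V^T = 1\<close>; taking determinants eliminates
  \<open>det V\<close>.\<close>

lemma det_frame_square: "(det A)\<^sup>2 = det (matrix (G_op D))"
proof -
  let ?M = "matrix (G_op D)"
  define V :: "((real, 'n) vec, 'n) vec" where "V = (\<chi> i. fst (h i))"
  have A: "A = V ** ?M"
  proof -
    have "A $ i = (V ** ?M) $ i" for i
    proof -
      have "A $ i = fst (h i) v* ?M"
        by (simp add: A_def G_op_matrix[OF lin, symmetric] transpose_matrix_vector[symmetric] transpose_matrix_G_op[OF lin])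
      then show ?thesis
        by (simp add: vec_eq_iff vector_matrix_mult_def matrix_matrix_mult_def V_def mult.commute)
    qed
    then show ?thesis by (simp add: vec_eq_iff)
  qed
  have "(A ** transpose V) $ i $ j = A $ i \<bullet> fst (h j)" for i j
    by (simp add: matrix_matrix_mult_def transpose_def V_def inner_vec_def)
  then have "A ** transpose V = mat 1"
    by (simp add: vec_eq_iff frame_dual mat_def)
  then have "det A * det V = 1"
    by (metis det_I det_mul det_transpose)
  moreover have "det A = det V * det ?M" by (simp add: A det_mul)
  ultimately show ?thesis
    by (metis mult.commute mult.left_commute mult_1 power2_eq_square)
qed

end

lemma oriented_orthonormal_basis_exists:
  fixes D :: "(real, 'n::{finite,linorder}) vec \<Rightarrow> (real, 'm::finite) vec"
  assumes lin: "linear D"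
  obtains es where "orthonormal_basis_of (range (\<lambda>u. (u, D u))) es" "0 < std_vol (map fst es)"
proof -
  obtain es where onb: "orthonormal_basis_of (range (\<lambda>u. (u, D u))) es"
    using orthonormal_basis_of_exists[OF subspace_graph[OF lin]] by blast
  have "length es = CARD('n)"
    using orthonormal_basis_of_length[OF onb] dim_graph[OF lin] by simp
  then obtain h :: "'n \<Rightarrow> _" where h: "es = map h coords"
    using list_indexed_by_coords by blast
  show thesis
  proof (cases "0 < std_vol (map fst es)")
    case True
    then show ?thesis using that onb by blast
  next
    case False
    \<comment> \<open>Any index would do: reversing one frame vector reverses the
      orientation.\<close>
    define k :: 'n where "k = undefined"
    define h' where "h' = h(k := - h k)"
    define es' where "es' = map h' coords"
    have "span (set es') = span (set es)"
    proof (rule span_eq[THEN iffD2], intro conjI subsetI)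
      fix x assume "x \<in> set es'"
      then show "x \<in> span (set es)"
        unfolding es'_def h h'_def by (auto simp: span_neg span_base)
    next
      fix x assume "x \<in> set es"
      then obtain i where "x = h i" by (auto simp: h)
      moreover have "h' i \<in> span (set es')" by (rule span_base) (simp add: es'_def)
      ultimately show "x \<in> span (set es')"
        using span_neg[of "h' i"] by (cases "i = k") (auto simp: h'_def)
    qed
    moreover have "h' i \<bullet> h' j = (if i = j then 1 else 0)" for i j
      by (simp add: h'_def frame_inner[OF lin onb h])
    ultimately have onb': "orthonormal_basis_of (range (\<lambda>u. (u, D u))) es'"
      using onb by (simp add: orthonormal_basis_of_def es'_def nth_eq_iff_index_eq)
    define A A' :: "((real, 'n) vec, 'n) vec"
      where "A = (\<chi> i. G_op D (fst (h i)))" and "A' = (\<chi> i. G_op D (fst (h' i)))"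
    have "det A * std_vol (map fst es) = 1" and d': "det A' * std_vol (map fst es') = 1"
      unfolding A_def A'_def using det_frame_mult_std_vol lin onb onb' h es'_def by blast+
    with False have "det A < 0"
      by (metis mult_nonneg_nonpos not_le not_one_le_zero)
    have "A' = (\<chi> i. if i = k then (-1) *s A $ i else A $ i)"
      by (auto simp: vec_eq_iff A_def A'_def h'_def linear_neg[OF G_op_linear[OF lin]])
    then have "det A' = (-1) * det (\<chi> i. if i = k then A $ i else A $ i)"
      by (simp only: det_row_mul)
    then have "det A' > 0" using \<open>det A < 0\<close> by simp
    with d' have "0 < std_vol (map fst es')"
      by (metis zero_less_mult_pos zero_less_one)
    then show ?thesis using that onb' by blast
  qed
qed

section \<open>Basis forms and coefficients of Theta\<close>

definition horizontal_form :: "((real, 'n::{finite,linorder}) vec \<times> (real, 'm::finite) vec) form" where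
  "horizontal_form = wedge_list (map (\<lambda>i. flat (axis i 1, 0)) coords)"

text \<open>The factor dy_a stays in the slot of dx_k, so no sign depending on \<open>k\<close>
  appears.\<close>

definition mixed_form :: "'n \<Rightarrow> 'm \<Rightarrow> ((real, 'n::{finite,linorder}) vec \<times> (real, 'm::finite) vec) form" where
  "mixed_form k a = wedge_list (map ((\<lambda>i. flat (axis i 1, 0))(k := flat (0, axis a 1))) coords)"

definition metric_matrix :: "(real^'n \<Rightarrow> real^'m) \<Rightarrow> real^'n \<Rightarrow> real^'n^'n" where
  "metric_matrix F x = matrix (G_op (frechet_derivative F (at x)))"

text \<open>Column \<open>k\<close> of \<open>sqrt g D G^(-1)\<close>, the gradient of the area
  density with respect to the partial derivative of \<open>F\<close> in direction
  \<open>k\<close>.\<close>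

definition flux :: "(real^'n \<Rightarrow> real^'m) \<Rightarrow> real^'n \<Rightarrow> 'n \<Rightarrow> real^'m" where
  "flux F x k = sqrt (det (metric_matrix F x)) *\<^sub>R
     frechet_derivative F (at x) (matrix_inv (metric_matrix F x) *v axis k 1)"

text \<open>The 1 is the contribution of \<open>exp(-Psi) vol\<close>; the trace of
  \<open>G^(-1) - I\<close> is what one more Psi adds to the dx component.\<close>

definition horizontal_coeff :: "(real^'n \<Rightarrow> real^'m) \<Rightarrow> real^'n \<Rightarrow> real" where
  "horizontal_coeff F x = sqrt (det (metric_matrix F x)) *
     (1 - real CARD('n) + (\<Sum>k\<in>UNIV. matrix_inv (metric_matrix F x) $ k $ k))"

lemma tangent_space_graph_map:
  assumes "F differentiable (at x)"
  shows "tangent_space (graph_map F) x = range (\<lambda>u. (u, frechet_derivative F (at x) u))"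
proof -
  have "(graph_map F has_derivative (\<lambda>u. (u, frechet_derivative F (at x) u))) (at x)"
    unfolding graph_map_def[abs_def] using frechet_derivative_works assms
    by (intro has_derivative_Pair has_derivative_ident) blast
  then show ?thesis
    unfolding tangent_space_def using frechet_derivative_at by metis
qed

lemma horizontal_form_eq:
  fixes vs :: "((real, 'n::{finite,linorder}) vec \<times> (real, 'm::finite) vec) list"
  shows "horizontal_form vs = wedge_list (map (\<lambda>i v. fst v $ i) coords) vs"
proof -
  have "flat (axis i 1, 0) = (\<lambda>v :: (real, 'n) vec \<times> (real, 'm) vec. fst v $ i)" for i :: 'n
    by (simp add: flat_def inner_prod_def inner_axis' fun_eq_iff)
  then show ?thesis by (simp add: horizontal_form_def)
qed

lemma Theta_form_eq:
  fixes F :: "(real, 'n::{finite,linorder}) vec \<Rightarrow> (real, 'm::finite) vec"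
  assumes "F differentiable (at (fst z))"
  shows "Theta_form F z vs = horizontal_coeff F (fst z) * horizontal_form vs +
    (\<Sum>k\<in>UNIV. \<Sum>a\<in>UNIV. flux F (fst z) k $ a * mixed_form k a vs)"
proof -
  define x where "x = fst z"
  define D where "D = frechet_derivative F (at x)"
  define es where "es = oriented_frame F x"
  define M where "M = metric_matrix F x"
  have lin: "linear D"
    using assms linear_frechet_derivative by (auto simp: D_def x_def)
  have M: "M = matrix (G_op D)" by (simp add: M_def metric_matrix_def D_def)
  have "orthonormal_basis_of (range (\<lambda>u. (u, D u))) es \<and> 0 < std_vol (map fst es)"
    unfolding es_def oriented_frame_def
    using oriented_orthonormal_basis_exists[OF lin] tangent_space_graph_map[of F x] assms
    by (simp add: D_def x_def) (rule someI_ex, blast)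
  then have onb: "orthonormal_basis_of (range (\<lambda>u. (u, D u))) es" and pos: "0 < std_vol (map fst es)"
    by auto
  have "length es = CARD('n)"
    using orthonormal_basis_of_length[OF onb] dim_graph[OF lin] by simp
  then obtain h :: "'n \<Rightarrow> _" where h: "es = map h coords"
    using list_indexed_by_coords by blast
  define A :: "((real, 'n) vec, 'n) vec" where "A = (\<chi> i. G_op D (fst (h i)))"
  have "det A * std_vol (map fst es) = 1"
    unfolding A_def using det_frame_mult_std_vol[OF lin onb h] .
  then have "det A > 0" using pos by (metis zero_less_mult_pos2 zero_less_one)
  moreover have "(det A)\<^sup>2 = det M"
    unfolding A_def M using det_frame_square[OF lin onb h] .
  ultimately have detA: "det A = sqrt (det M)"
    by (metis less_imp_le real_sqrt_unique)
  let ?r = "replace_deriv (J_op D) es"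
  define S where "S = wedge_list (map (\<lambda>e. flat (e - J_op D e)) es)"
  have Psi: "Psi F x = ?r"
    by (simp add: Psi_def replace_deriv_def fun_eq_iff es_def D_def)
  have "Theta_form F z vs = S vs + ?r S vs"
    using alternating_sum_replace_deriv[of es "J_op D" vs] extend_frame_J_op[OF lin onb]
    by (simp add: Theta_form_def Psi_pow_def Psi vol_graph_def x_def[symmetric] es_def[symmetric] S_def)
  moreover have S: "S = (\<lambda>vs. sqrt (det M) * horizontal_form vs)"
  proof
    fix vs
    have "S = wedge_list (map (\<lambda>i v. A $ i \<bullet> fst v) coords)"
      unfolding S_def h map_map o_def
      by (intro arg_cong[where f = wedge_list] map_cong refl)
        (simp add: extend_frame_J_op(3)[OF lin onb] h flat_def A_def inner_prod_def fun_eq_iff)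
    then show "S vs = sqrt (det M) * horizontal_form vs"
      by (simp add: wedge_list_rows_eq_det detA horizontal_form_eq)
  qed
  moreover have "?r horizontal_form vs = 
     (\<Sum>k\<in>UNIV. (matrix_inv M $ k $ k - 1) * horizontal_form vs + 
       (\<Sum>a\<in>UNIV. D (matrix_inv M *v axis k 1) $ a * mixed_form k a vs))"
  proof -
    let ?ax = "\<lambda>i. (axis i 1, 0) :: (real, 'n) vec \<times> (real, 'm) vec"
    let ?P = "extend_frame (J_op D) es"
    have upd: "(map f (coords::'n list))[p := y] = map (f(coords ! p := y)) coords" if "p < CARD('n)" for p f y
      using that by (auto intro!: nth_equalityI simp: nth_list_update nth_eq_iff_index_eq)
    have "?r horizontal_form vs = ?r (wedge_list (map flat (map ?ax coords))) vs"
      by (simp add: horizontal_form_def o_def)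
    also have "\<dots> = (\<Sum>p<CARD('n). wedge_list (map ((flat \<circ> ?ax)(coords ! p := flat (?P (?ax (coords ! p))))) coords) vs)"
      unfolding replace_deriv_wedge_list by (simp add: upd)
    also have "\<dots> = (\<Sum>k\<in>UNIV. wedge_list (map ((flat \<circ> ?ax)(k := flat (?P (?ax k)))) coords) vs)"
      by (rule sum.reindex_bij_betw[OF bij_betw_nth]) auto
    also have "\<dots> = (\<Sum>k\<in>UNIV. (matrix_inv M $ k $ k - 1) * horizontal_form vs + 
       (\<Sum>a\<in>UNIV. D (matrix_inv M *v axis k 1) $ a * mixed_form k a vs))"
    proof (intro sum.cong refl)
      fix k :: 'n
      define s where "s = matrix_inv M *v axis k 1"
      have Gs: "G_op D s = axis k 1"
        unfolding s_def M by (rule G_op_matrix_inv[OF lin])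
      define t where "t = - adjoint D (D s)"
      \<comment> \<open>From \<open>G s = s + D^* D s\<close>; this is the source of the diagonal
        coefficient \<open>matrix_inv M $ k $ k - 1\<close>.\<close>
      have t: "t = s - axis k 1" using Gs by (simp add: G_op_def t_def algebra_simps)
      have "flat (?P (?ax k)) = flat (t, D s)"
        using extend_frame_horizontal[OF lin onb Gs] by (simp add: t_def)
      \<comment> \<open>The sum type indexes the dx_j and dy_a together, so that one multilinear
        expansion covers both.\<close>
      also have "\<dots> = (\<lambda>v. \<Sum>c\<in>UNIV. (case c of Inl j \<Rightarrow> t $ j | Inr a \<Rightarrow> D s $ a) * 
         flat (case c of Inl j \<Rightarrow> ?ax j | Inr a \<Rightarrow> (0, axis a 1)) v)"
      proof
        fix v :: "(real, 'n) vec \<times> (real, 'm) vec"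
        have "flat (t, D s) v = (\<Sum>j\<in>UNIV. t $ j * fst v $ j) + (\<Sum>a\<in>UNIV. D s $ a * snd v $ a)"
          by (simp add: flat_def inner_prod_def inner_vec_def)
        also have "\<dots> = (\<Sum>j\<in>UNIV. t $ j * flat (?ax j) v) + (\<Sum>a\<in>UNIV. D s $ a * flat (0, axis a 1) v)"
          by (simp add: flat_def inner_prod_def inner_axis')
        finally show "flat (t, D s) v = (\<Sum>c\<in>UNIV. (case c of Inl j \<Rightarrow> t $ j | Inr a \<Rightarrow> D s $ a) * 
         flat (case c of Inl j \<Rightarrow> ?ax j | Inr a \<Rightarrow> (0, axis a 1)) v)"
          by (simp add: UNIV_Plus_UNIV[symmetric] sum.Plus del: UNIV_Plus_UNIV)
      qed
      finally have "wedge_list (map ((flat \<circ> ?ax)(k := flat (?P (?ax k)))) coords) vs = 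
        (\<Sum>c\<in>UNIV. (case c of Inl j \<Rightarrow> t $ j | Inr a \<Rightarrow> D s $ a) * 
          wedge_list (map ((flat \<circ> ?ax)(k := flat (case c of Inl j \<Rightarrow> ?ax j | Inr a \<Rightarrow> (0, axis a 1)))) coords) vs)"
        by (simp only: wedge_list_map_update_sum distinct_sorted_list_of_set set_sorted_list_of_set finite UNIV_I)
      also have "\<dots> = (\<Sum>j\<in>UNIV. t $ j * wedge_list (map ((flat \<circ> ?ax)(k := flat (?ax j))) coords) vs) +
          (\<Sum>a\<in>UNIV. D s $ a * mixed_form k a vs)"
        by (simp add: UNIV_Plus_UNIV[symmetric] sum.Plus mixed_form_def o_def del: UNIV_Plus_UNIV)
      \<comment> \<open>For \<open>j\<close> other than \<open>k\<close> the factor dx_j is already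
        present and the product vanishes.\<close>
      also have "(\<Sum>j\<in>UNIV. t $ j * wedge_list (map ((flat \<circ> ?ax)(k := flat (?ax j))) coords) vs) =
          (\<Sum>j\<in>UNIV. if j = k then t $ k * horizontal_form vs else 0)"
      proof (intro sum.cong refl)
        fix j :: 'n
        show "t $ j * wedge_list (map ((flat \<circ> ?ax)(k := flat (?ax j))) coords) vs = (if j = k then t $ k * horizontal_form vs else 0)"
        proof (cases "j = k")
          case True
          have "(flat \<circ> ?ax)(k := flat (?ax k)) = (\<lambda>i. flat (?ax i))" by auto
          then show ?thesis using True by (simp add: horizontal_form_def)
        next
          case False
          have "\<not> inj ((flat \<circ> ?ax)(k := flat (?ax j)))"
            using False by (auto dest!: injD[of _ j k])
          then have "\<not> distinct (map ((flat \<circ> ?ax)(k := flat (?ax j))) coords)"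
            by (simp add: distinct_map)
          then show ?thesis using False by (simp add: wedge_list_not_distinct)
        qed
      qed
      also have "\<dots> = (matrix_inv M $ k $ k - 1) * horizontal_form vs"
        by (simp add: t s_def matrix_vector_mult_basis column_def)
      finally show "wedge_list (map ((flat \<circ> ?ax)(k := flat (?P (?ax k)))) coords) vs =
         (matrix_inv M $ k $ k - 1) * horizontal_form vs + 
         (\<Sum>a\<in>UNIV. D (matrix_inv M *v axis k 1) $ a * mixed_form k a vs)"
        by (simp only: s_def)
    qed
    finally show ?thesis .
  qed
  ultimately have "Theta_form F z vs = sqrt (det M) * horizontal_form vs + sqrt (det M) *
    (\<Sum>k\<in>UNIV. (matrix_inv M $ k $ k - 1) * horizontal_form vs +
       (\<Sum>a\<in>UNIV. D (matrix_inv M *v axis k 1) $ a * mixed_form k a vs))"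
    by (simp only: replace_deriv_scale)
  then show ?thesis
    by (simp add: horizontal_coeff_def flux_def x_def[symmetric] M_def[symmetric] D_def[symmetric]
        sum.distrib sum_subtractf sum_distrib_left sum_distrib_right algebra_simps)
qed

section \<open>The exterior derivative of \<open>\<Theta>(F)\<close>\<close>

lemma wedge1_horizontal_linear:
  fixes l :: "(real, 'n::{finite,linorder}) vec \<Rightarrow> real"
    and \<xi> :: "((real, 'n) vec \<times> (real, 'm::finite) vec) form"
  assumes "linear l"
  shows "wedge1 (\<lambda>v. l (fst v)) \<xi> vs = (\<Sum>j\<in>UNIV. l (axis j 1) * wedge1 (flat (axis j 1, 0)) \<xi> vs)"
proof -
  have "l (fst v) = (\<Sum>j\<in>UNIV. l (axis j 1) * flat (axis j 1, 0) v)" for v :: "(real, 'n) vec \<times> (real, 'm) vec"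
  proof -
    have "fst v = (\<Sum>j\<in>UNIV. (fst v $ j) *\<^sub>R axis j 1)"
      using basis_expansion[of "fst v"] by (simp add: scalar_mult_eq_scaleR)
    then have "l (fst v) = (\<Sum>j\<in>UNIV. fst v $ j * l (axis j 1))"
      using linear_sum[OF assms, of "\<lambda>j. (fst v $ j) *\<^sub>R axis j 1" UNIV] linear_scale[OF assms] by simp
    then show ?thesis by (simp add: flat_def inner_prod_def inner_axis' mult.commute)
  qed
  then show ?thesis by (simp only: wedge1_sum_left)
qed

lemma wedge1_horizontal_form [simp]: "wedge1 (flat (axis j 1, 0)) horizontal_form = (\<lambda>vs. 0)"
  unfolding horizontal_form_def by (rule wedge1_wedge_list_member) auto

lemma wedge1_mixed_form:
  "wedge1 (flat (axis j 1, 0)) (mixed_form k a) vs =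
    (if j = k then - wedge1 (flat (0, axis a 1)) horizontal_form vs else 0)"
proof (cases "j = k")
  case True
  let ?as = "map (\<lambda>i. flat (axis i 1, 0)) coords"
  obtain p where p: "p < length (coords :: 'a list)" "coords ! p = k"
    by (metis UNIV_I finite in_set_conv_nth set_sorted_list_of_set)
  then have eq: "map ((\<lambda>i. flat (axis i 1, 0))(k := flat (0, axis a 1))) coords = ?as[p := flat (0, axis a 1)]"
    by (auto intro!: nth_equalityI simp: nth_list_update nth_eq_iff_index_eq)
  then show ?thesis
    using wedge_list_update_swap[of p ?as "flat (0, axis a 1)" vs] p True
    unfolding mixed_form_def horizontal_form_def eq by simp
next
  case False
  then have "flat (axis j 1, 0) \<in> set (map ((\<lambda>i. flat (axis i 1, 0))(k := flat (0, axis a 1))) coords)"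
    by auto
  then have "wedge1 (flat (axis j 1, 0)) (mixed_form k a) = (\<lambda>vs. 0)"
    unfolding mixed_form_def by (rule wedge1_wedge_list_member)
  then show ?thesis using False by simp
qed

text \<open>These arguments separate the forms dy_a wedge dx, so the coefficients of the exterior
  derivative can be read off one at a time.\<close>

lemma wedge1_vertical_horizontal_form:
  fixes a b :: "'m::finite"
  shows "wedge1 (flat (0, axis a 1)) horizontal_form
     ((0, axis b 1) # map (\<lambda>i. (axis i 1, 0)) (coords :: 'n::{finite,linorder} list)) = (if a = b then 1 else 0)"
proof -
  let ?e = "(0, axis b 1) :: (real, 'n) vec \<times> (real, 'm) vec"
  have "interior_mult ?e horizontal_form = (\<lambda>vs. 0)"
    unfolding horizontal_form_def by (rule interior_mult_wedge_list_zero) (auto simp: flat_def)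
  moreover have "horizontal_form (map (\<lambda>i. (axis i 1, 0 :: (real, 'm) vec)) (coords :: 'n list)) = 1"
    unfolding horizontal_form_def
    by (rule wedge_list_dual) (auto simp: flat_def inner_axis_axis nth_eq_iff_index_eq)
  ultimately show ?thesis
    by (simp add: wedge1_Cons flat_def inner_axis_axis)
qed

text \<open>The horizontal part of \<open>\<Theta>\<close> is closed as its coefficient depends only on \<open>x\<close>.\<close>
lemma closed_Theta_form_iff:
  fixes F :: "(real, 'n::{finite,linorder}) vec \<Rightarrow> (real, 'm::finite) vec"
  assumes U: "open U" and F: "\<And>x. x \<in> U \<Longrightarrow> F differentiable (at x)"
    and q: "\<And>x. x \<in> U \<Longrightarrow> horizontal_coeff F differentiable (at x)"
    and B: "\<And>x k. x \<in> U \<Longrightarrow> (\<lambda>y. flux F y k) differentiable (at x)"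
  shows "closed_form_on CARD('n) (U \<times> UNIV) (Theta_form F) \<longleftrightarrow>
    (\<forall>x\<in>U. (\<Sum>k\<in>UNIV. frechet_derivative (\<lambda>y. flux F y k) (at x) (axis k 1)) = 0)"
proof -
  define q' where "q' x = frechet_derivative (horizontal_coeff F) (at x)" for x
  define B' where "B' x k = frechet_derivative (\<lambda>y. flux F y k) (at x)" for x k
  have dq: "(horizontal_coeff F has_derivative q' x) (at x)" if "x \<in> U" for x
    using q[OF that] by (simp add: q'_def frechet_derivative_works)
  have dB: "((\<lambda>y. flux F y k) has_derivative B' x k) (at x)" if "x \<in> U" for x k
    using B[OF that] by (simp add: B'_def frechet_derivative_works)
  have lq: "linear (q' x)" if "x \<in> U" for x using dq[OF that] has_derivative_linear by blast
  have lB: "linear (\<lambda>v. B' x k v $ a)" if "x \<in> U" for x k a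
    using has_derivative_linear[OF dB[OF that]] by (simp add: linear_iff)
  have D: "((\<lambda>y. Theta_form F y vs) has_derivative
      (\<lambda>v. q' (fst z) (fst v) * horizontal_form vs +
        (\<Sum>k\<in>UNIV. \<Sum>a\<in>UNIV. B' (fst z) k (fst v) $ a * mixed_form k a vs))) (at z)"
    if z: "z \<in> U \<times> UNIV" for z vs
  \<comment> \<open>The derivative is taken of the explicit formula and transferred to
    \<open>Theta_form\<close>, which agrees with it on the open set but is defined through pointwise
    choices.\<close>
  proof (rule has_derivative_transform_within_open)
    show "open (U \<times> (UNIV :: (real, 'm) vec set))" using U by (simp add: open_Times)
    show "z \<in> U \<times> UNIV" by fact
    show "horizontal_coeff F (fst y) * horizontal_form vs +
      (\<Sum>k\<in>UNIV. \<Sum>a\<in>UNIV. flux F (fst y) k $ a * mixed_form k a vs) = Theta_form F y vs"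
      if "y \<in> U \<times> UNIV" for y
      using that F by (subst Theta_form_eq) auto
    have x: "fst z \<in> U" using z by auto
    have fst: "(fst has_derivative fst) (at z)" by (rule has_derivative_fst[OF has_derivative_ident])
    have "((\<lambda>y. horizontal_coeff F (fst y)) has_derivative (\<lambda>v. q' (fst z) (fst v))) (at z)"
      by (rule has_derivative_compose[OF fst dq[OF x]])
    moreover have "((\<lambda>y. flux F (fst y) k $ a) has_derivative (\<lambda>v. B' (fst z) k (fst v) $ a)) (at z)" for k a
      by (rule bounded_linear.has_derivative[OF bounded_linear_vec_nth has_derivative_compose[OF fst dB[OF x]]])
    ultimately show "((\<lambda>y. horizontal_coeff F (fst y) * horizontal_form vs +
      (\<Sum>k\<in>UNIV. \<Sum>a\<in>UNIV. flux F (fst y) k $ a * mixed_form k a vs)) has_derivative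
      (\<lambda>v. q' (fst z) (fst v) * horizontal_form vs +
        (\<Sum>k\<in>UNIV. \<Sum>a\<in>UNIV. B' (fst z) k (fst v) $ a * mixed_form k a vs))) (at z)"
      by (intro has_derivative_add has_derivative_sum has_derivative_mult_left)
  qed
  have ext: "ext_deriv (Theta_form F) z vs =
      - (\<Sum>a\<in>UNIV. (\<Sum>k\<in>UNIV. B' (fst z) k (axis k 1)) $ a * wedge1 (flat (0, axis a 1)) horizontal_form vs)"
    if z: "z \<in> U \<times> UNIV" for z vs
  proof -
    have x: "fst z \<in> U" using z by auto
    have "ext_deriv (Theta_form F) z vs = (\<Sum>i<length vs. (-1) ^ i *
       (q' (fst z) (fst (vs ! i)) * horizontal_form (omit i vs) +
        (\<Sum>k\<in>UNIV. \<Sum>a\<in>UNIV. B' (fst z) k (fst (vs ! i)) $ a * mixed_form k a (omit i vs))))"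
      unfolding ext_deriv_def frechet_derivative_at[OF D[OF z], symmetric] ..
    also have "\<dots> = wedge1 (\<lambda>v. q' (fst z) (fst v)) horizontal_form vs + 
       (\<Sum>i<length vs. \<Sum>k\<in>UNIV. \<Sum>a\<in>UNIV. (-1) ^ i * B' (fst z) k (fst (vs ! i)) $ a * mixed_form k a (omit i vs))"
      by (simp add: wedge1_def distrib_left sum.distrib sum_distrib_left mult.assoc)
    also have "(\<Sum>i<length vs. \<Sum>k\<in>UNIV. \<Sum>a\<in>UNIV. (-1) ^ i * B' (fst z) k (fst (vs ! i)) $ a * mixed_form k a (omit i vs)) =
       (\<Sum>k\<in>UNIV. \<Sum>a\<in>UNIV. wedge1 (\<lambda>v. B' (fst z) k (fst v) $ a) (mixed_form k a) vs)"
      unfolding wedge1_def by (subst sum.swap, rule sum.cong, rule refl, rule sum.swap)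
    also have "wedge1 (\<lambda>v. q' (fst z) (fst v)) horizontal_form vs = 0"
      by (simp add: wedge1_horizontal_linear[OF lq[OF x]])
    also have "(\<Sum>k\<in>UNIV. \<Sum>a\<in>UNIV. wedge1 (\<lambda>v. B' (fst z) k (fst v) $ a) (mixed_form k a) vs) =
       (\<Sum>k\<in>UNIV. \<Sum>a\<in>UNIV. - (B' (fst z) k (axis k 1) $ a * wedge1 (flat (0, axis a 1)) horizontal_form vs))"
      by (simp add: wedge1_horizontal_linear[OF lB[OF x]] wedge1_mixed_form if_distrib cong: if_cong)
    also have "\<dots> = - (\<Sum>a\<in>UNIV. (\<Sum>k\<in>UNIV. B' (fst z) k (axis k 1)) $ a * wedge1 (flat (0, axis a 1)) horizontal_form vs)"
      by (subst sum.swap) (simp add: sum_negf sum_distrib_right)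
    finally show ?thesis by simp
  qed
  show ?thesis
  proof
    assume c: "closed_form_on CARD('n) (U \<times> UNIV) (Theta_form F)"
    show "\<forall>x\<in>U. (\<Sum>k\<in>UNIV. frechet_derivative (\<lambda>y. flux F y k) (at x) (axis k 1)) = 0"
    proof
      fix x assume x: "x \<in> U"
      have "(\<Sum>k\<in>UNIV. B' x k (axis k 1)) $ b = 0" for b
      proof -
        \<comment> \<open>This list isolates component \<open>b\<close> of the divergence; height 0
          represents the whole fibre, as the coefficients depend only on \<open>x\<close>.\<close>
        let ?vs = "(0, axis b 1) # map (\<lambda>i. (axis i 1, 0)) (coords :: 'n list)"
        have "ext_deriv (Theta_form F) (x, 0) ?vs = 0"
          using c x by (simp add: closed_form_on_def)
        then have "(\<Sum>a\<in>UNIV. (\<Sum>k\<in>UNIV. B' x k (axis k 1)) $ a * (if a = b then 1 else 0)) = 0"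
          using x by (subst (asm) ext) (simp_all only: wedge1_vertical_horizontal_form, auto)
        then show ?thesis by (simp add: if_distrib cong: if_cong)
      qed
      then show "(\<Sum>k\<in>UNIV. frechet_derivative (\<lambda>y. flux F y k) (at x) (axis k 1)) = 0"
        by (simp add: vec_eq_iff B'_def)
    qed
  next
    assume "\<forall>x\<in>U. (\<Sum>k\<in>UNIV. frechet_derivative (\<lambda>y. flux F y k) (at x) (axis k 1)) = 0"
    then have "(\<Sum>k\<in>UNIV. B' (fst z) k (axis k 1)) = 0" if "z \<in> U \<times> UNIV" for z :: "_ \<times> (real, 'm) vec"
      using that by (auto simp: B'_def)
    then show "closed_form_on CARD('n) (U \<times> UNIV) (Theta_form F)"
      unfolding closed_form_on_def using differentiableI[OF D] ext by auto
  qed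
qed

section \<open>Hessians, determinants and the divergence identity\<close>

text \<open>The mean value theorem is applied along \<open>v\<close> to the increment in direction
  \<open>w\<close>, and then along \<open>w\<close>. The left side is symmetric in \<open>v\<close>
  and \<open>w\<close>, which is what makes it useful.\<close>

lemma second_difference_mean_value:
  fixes f :: "'a::euclidean_space \<Rightarrow> real"
  assumes "s > 0" and seg: "\<And>t r. 0 \<le> t \<Longrightarrow> t \<le> s \<Longrightarrow> 0 \<le> r \<Longrightarrow> r \<le> s \<Longrightarrow> x + t *\<^sub>R v + r *\<^sub>R w \<in> U"
    and f: "\<And>y. y \<in> U \<Longrightarrow> (f has_derivative f' y) (at y)"
    and f': "\<And>y. y \<in> U \<Longrightarrow> ((\<lambda>y. f' y v) has_derivative f'' y) (at y)"
  obtains t r where "0 < t" "t < s" "0 < r" "r < s"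
    "f (x + s *\<^sub>R v + s *\<^sub>R w) - f (x + s *\<^sub>R v) - f (x + s *\<^sub>R w) + f x = s\<^sup>2 * f'' (x + t *\<^sub>R v + r *\<^sub>R w) w"
proof -
  \<comment> \<open>The term \<open>0 *\<^sub>R w\<close> is kept so that both summands have the
    shape treated in \<open>D1\<close>.\<close>
  define \<phi> where "\<phi> t = f (x + t *\<^sub>R v + s *\<^sub>R w) - f (x + t *\<^sub>R v + 0 *\<^sub>R w)" for t
  define \<phi>' where "\<phi>' t = f' (x + t *\<^sub>R v + s *\<^sub>R w) v - f' (x + t *\<^sub>R v + 0 *\<^sub>R w) v" for t
  have D1: "((\<lambda>t. f (x + t *\<^sub>R v + r *\<^sub>R w)) has_real_derivative f' (x + t *\<^sub>R v + r *\<^sub>R w) v) (at t)"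
    if "0 \<le> t" "t \<le> s" "0 \<le> r" "r \<le> s" for t r
  proof -
    have "((\<lambda>t. x + t *\<^sub>R v + r *\<^sub>R w) has_derivative (\<lambda>h. h *\<^sub>R v)) (at t)"
      by (auto intro!: derivative_eq_intros)
    from has_derivative_compose[OF this f[OF seg[OF that]]]
    show ?thesis
      unfolding has_field_derivative_def
      by (rule has_derivative_eq_rhs) (simp add: fun_eq_iff linear_scale[OF has_derivative_linear[OF f[OF seg[OF that]]]])
  qed
  have D2: "((\<lambda>r. f' (x + t *\<^sub>R v + r *\<^sub>R w) v) has_real_derivative f'' (x + t *\<^sub>R v + r *\<^sub>R w) w) (at r)"
    if "0 \<le> t" "t \<le> s" "0 \<le> r" "r \<le> s" for t r
  proof -
    have "((\<lambda>r. x + t *\<^sub>R v + r *\<^sub>R w) has_derivative (\<lambda>h. h *\<^sub>R w)) (at r)"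
      by (auto intro!: derivative_eq_intros)
    from has_derivative_compose[OF this f'[OF seg[OF that]]]
    show ?thesis
      unfolding has_field_derivative_def
      by (rule has_derivative_eq_rhs) (simp add: fun_eq_iff linear_scale[OF has_derivative_linear[OF f'[OF seg[OF that]]]])
  qed
  have "(\<phi> has_real_derivative \<phi>' t) (at t)" if "0 \<le> t" "t \<le> s" for t
    unfolding \<phi>_def \<phi>'_def using that \<open>s > 0\<close> by (intro DERIV_diff D1) auto
  then obtain t where t: "0 < t" "t < s" "\<phi> s - \<phi> 0 = (s - 0) * \<phi>' t"
    using MVT2[OF \<open>s > 0\<close>, of \<phi> \<phi>'] by blast
  obtain r where r: "0 < r" "r < s" "\<phi>' t = s * f'' (x + t *\<^sub>R v + r *\<^sub>R w) w"
    using MVT2[OF \<open>s > 0\<close>, of "\<lambda>r. f' (x + t *\<^sub>R v + r *\<^sub>R w) v" "\<lambda>r. f'' (x + t *\<^sub>R v + r *\<^sub>R w) w"] t D2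
    unfolding \<phi>'_def by auto
  have "f (x + s *\<^sub>R v + s *\<^sub>R w) - f (x + s *\<^sub>R v) - f (x + s *\<^sub>R w) + f x = \<phi> s - \<phi> 0"
    by (simp add: \<phi>_def)
  also have "\<dots> = s\<^sup>2 * f'' (x + t *\<^sub>R v + r *\<^sub>R w) w"
    using t(3) r(3) by (simp add: power2_eq_square)
  finally show ?thesis using that t r by blast
qed

text \<open>One second difference equals \<open>s^2\<close> times a mixed derivative in either
  order, at two points near \<open>x\<close>; continuity brings both values back to
  \<open>x\<close>.\<close>

lemma symmetric_second_derivative_real:
  fixes f :: "'a::euclidean_space \<Rightarrow> real"
  assumes "open U" "x \<in> U"
    and f: "\<And>y. y \<in> U \<Longrightarrow> (f has_derivative f' y) (at y)"
    and f': "\<And>y v. y \<in> U \<Longrightarrow> ((\<lambda>y. f' y v) has_derivative f'' y v) (at y)"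
    and cont: "\<And>v w. continuous_on U (\<lambda>y. f'' y v w)"
  shows "f'' x v w = f'' x w v"
proof (rule ccontr)
  assume "f'' x v w \<noteq> f'' x w v"
  \<comment> \<open>Half the supposed gap: a common value within \<open>e\<close> of both numbers is
    then impossible.\<close>
  define e where "e = \<bar>f'' x v w - f'' x w v\<bar> / 2"
  have "e > 0" using \<open>f'' x v w \<noteq> _\<close> by (simp add: e_def)
  have "isCont (\<lambda>y. f'' y v w) x" "isCont (\<lambda>y. f'' y w v) x"
    using cont assms(1,2) by (auto simp: continuous_on_eq_continuous_at)
  then obtain d1 d2 where d: "d1 > 0" "\<And>y. dist y x < d1 \<Longrightarrow> dist (f'' y v w) (f'' x v w) < e"
    "d2 > 0" "\<And>y. dist y x < d2 \<Longrightarrow> dist (f'' y w v) (f'' x w v) < e"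
    unfolding continuous_at_eps_delta using \<open>e > 0\<close> by metis
  obtain d0 where d0: "d0 > 0" "ball x d0 \<subseteq> U"
    using assms(1,2) openE by blast
  define d where "d = min d0 (min d1 d2)"
  have "d > 0" using d d0 by (simp add: d_def)
  \<comment> \<open>Keeps the whole parallelogram inside the ball of radius \<open>d\<close>; the
    summand 1 avoids a zero denominator.\<close>
  define s where "s = d / (norm v + norm w + 1)"
  have pos: "norm v + norm w + 1 > 0" by (simp add: add_nonneg_pos)
  then have "s > 0" using \<open>d > 0\<close> by (simp add: s_def)
  have near: "dist (x + t *\<^sub>R a + r *\<^sub>R b) x < d"
    if "0 \<le> t" "t \<le> s" "0 \<le> r" "r \<le> s" "{a, b} = {v, w}" for t r a b
  proof -
    have "dist (x + t *\<^sub>R a + r *\<^sub>R b) x \<le> t * norm a + r * norm b"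
      using norm_triangle_ineq[of "t *\<^sub>R a" "r *\<^sub>R b"] that by (simp add: dist_norm add.assoc)
    also have "\<dots> \<le> s * norm a + s * norm b"
      using that by (intro add_mono mult_right_mono) auto
    also have "\<dots> = s * (norm v + norm w)"
      using that(5) by (auto simp: doubleton_eq_iff algebra_simps)
    also have "\<dots> < s * (norm v + norm w + 1)" using \<open>s > 0\<close> by simp
    also have "\<dots> = d" using pos by (simp add: s_def)
    finally show ?thesis .
  qed
  have inU: "y \<in> U" if "dist y x < d" for y
    using that d0(2) by (auto simp: d_def dist_commute mem_ball subset_iff)
  obtain t1 r1 where 1: "0 < t1" "t1 < s" "0 < r1" "r1 < s"
    "f (x + s *\<^sub>R v + s *\<^sub>R w) - f (x + s *\<^sub>R v) - f (x + s *\<^sub>R w) + f x = s\<^sup>2 * f'' (x + t1 *\<^sub>R v + r1 *\<^sub>R w) v w"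
    by (rule second_difference_mean_value[OF \<open>s > 0\<close>, of x v w U f f' "\<lambda>y. f'' y v"]) (use near inU f f' in auto)
  obtain t2 r2 where 2: "0 < t2" "t2 < s" "0 < r2" "r2 < s"
    "f (x + s *\<^sub>R w + s *\<^sub>R v) - f (x + s *\<^sub>R w) - f (x + s *\<^sub>R v) + f x = s\<^sup>2 * f'' (x + t2 *\<^sub>R w + r2 *\<^sub>R v) w v"
    by (rule second_difference_mean_value[OF \<open>s > 0\<close>, of x w v U f f' "\<lambda>y. f'' y w"])
      (use near[of _ _ w v] inU f f' in \<open>auto simp: insert_commute\<close>)
  have "x + s *\<^sub>R v + s *\<^sub>R w = x + s *\<^sub>R w + s *\<^sub>R v" by simp
  with 1(5) 2(5) have "s\<^sup>2 * f'' (x + t1 *\<^sub>R v + r1 *\<^sub>R w) v w = s\<^sup>2 * f'' (x + t2 *\<^sub>R w + r2 *\<^sub>R v) w v"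
    by (simp only:)
  then have eq: "f'' (x + t1 *\<^sub>R v + r1 *\<^sub>R w) v w = f'' (x + t2 *\<^sub>R w + r2 *\<^sub>R v) w v"
    using \<open>s > 0\<close> by simp
  have "dist (f'' (x + t1 *\<^sub>R v + r1 *\<^sub>R w) v w) (f'' x v w) < e"
    using near[of t1 r1 v w] 1 by (intro d(2)) (auto simp: d_def)
  moreover have "dist (f'' (x + t2 *\<^sub>R w + r2 *\<^sub>R v) w v) (f'' x w v) < e"
    using near[of t2 r2 w v] 2 by (intro d(4)) (auto simp: d_def insert_commute)
  ultimately have "\<bar>f'' x v w - f'' x w v\<bar> < 2 * e"
    unfolding eq dist_real_def by linarith
  then show False by (simp add: e_def)
qed

lemma symmetric_second_derivative:
  fixes f :: "'a::euclidean_space \<Rightarrow> 'b::euclidean_space"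
  assumes "open U" "x \<in> U"
    and f: "\<And>y. y \<in> U \<Longrightarrow> (f has_derivative f' y) (at y)"
    and f': "\<And>y v. y \<in> U \<Longrightarrow> ((\<lambda>y. f' y v) has_derivative f'' y v) (at y)"
    and cont: "\<And>v w. continuous_on U (\<lambda>y. f'' y v w)"
  shows "f'' x v w = f'' x w v"
proof (rule euclidean_eqI)
  fix b :: 'b assume "b \<in> Basis"
  show "f'' x v w \<bullet> b = f'' x w v \<bullet> b"
    by (rule symmetric_second_derivative_real[OF assms(1,2), of "\<lambda>y. f y \<bullet> b" "\<lambda>y v. f' y v \<bullet> b" "\<lambda>y v w. f'' y v w \<bullet> b"])
      (auto intro!: has_derivative_inner_left f f' continuous_intros cont)
qed

section \<open>Differentiating determinants\<close>

text \<open>The product rule in the Leibniz formula, regrouped by the differentiated row;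
  \<open>det_replace_row\<close> then yields Jacobi's formula.\<close>

lemma has_derivative_det:
  fixes A :: "'a::real_normed_vector \<Rightarrow> real^'n^'n"
  assumes "\<And>i j. ((\<lambda>y. A y $ i $ j) has_derivative A' i j) (at x)"
  shows "((\<lambda>y. det (A y)) has_derivative
    (\<lambda>w. \<Sum>i\<in>UNIV. det (\<chi> k. if k = i then (\<chi> j. A' i j w) else A x $ k))) (at x)"
proof -
  have "((\<lambda>y. det (A y)) has_derivative
    (\<lambda>w. \<Sum>p | p permutes UNIV. of_int (sign p) *
       (\<Sum>i\<in>UNIV. A' i (p i) w * (\<Prod>j\<in>UNIV - {i}. A x $ j $ p j)))) (at x)"
    unfolding det_def
    by (intro has_derivative_sum has_derivative_mult_right has_derivative_prod assms)
  moreover have "(\<Sum>p | p permutes UNIV. of_int (sign p) *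
       (\<Sum>i\<in>UNIV. A' i (p i) w * (\<Prod>j\<in>UNIV - {i}. A x $ j $ p j))) =
     (\<Sum>i\<in>UNIV. det (\<chi> k. if k = i then (\<chi> j. A' i j w) else A x $ k))" for w
  proof -
    have "(\<Prod>k\<in>UNIV. (if k = i then (\<chi> j. A' i j w) else A x $ k) $ p k) =
       A' i (p i) w * (\<Prod>j\<in>UNIV - {i}. A x $ j $ p j)" for i p
      by (subst prod.remove[of _ i]) (auto intro!: prod.cong)
    then show ?thesis
      unfolding det_def vec_lambda_beta sum_distrib_left by (subst sum.swap) simp
  qed
  ultimately show ?thesis by simp
qed

text \<open>Cramer's rule: write \<open>r\<close> as a combination of the rows of \<open>A\<close>,
  with coefficients \<open>r v* B\<close>; only the coefficient of row \<open>i\<close>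
  survives.\<close>

lemma det_replace_row:
  fixes A B :: "real^'n^'n"
  assumes "B ** A = mat 1"
  shows "det (\<chi> k. if k = i then r else A $ k) = det A * (\<Sum>j\<in>UNIV. r $ j * B $ j $ i)"
proof -
  define c where "c = r v* B"
  have "r = c v* A"
    using assms by (simp add: c_def vector_matrix_mul_assoc)
  then have eq: "r = (\<Sum>k\<in>UNIV. c $ k *s row k A)"
    by (simp add: vec_eq_iff vector_matrix_mult_def row_def mult.commute)
  have "det (\<chi> k. if k = i then r else row k A) = c $ i * det A"
    by (subst eq) (rule cramer_lemma_transpose)
  moreover have row: "row k A = A $ k" for k by (simp add: row_def vec_eq_iff)
  ultimately show ?thesis
    unfolding row by (simp add: c_def vector_matrix_mult_def mult.commute)
qed

text \<open>The logarithmic derivative of \<open>\<surd>g\<close> cancels against the first half of the derivative of the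
  inverse metric.\<close>
lemma divergence_cancellation:
  fixes K :: "'n::finite \<Rightarrow> 'n \<Rightarrow> real" and d :: "'n \<Rightarrow> 'b::real_inner"
  assumes K: "\<And>i j. K i j = K j i" and h: "\<And>i j. h i j = h j i"
  defines "R \<equiv> (\<Sum>k\<in>UNIV. \<Sum>j\<in>UNIV. K j k *\<^sub>R h j k)"
  shows "(\<Sum>k\<in>UNIV. \<Sum>j\<in>UNIV. ((\<Sum>i\<in>UNIV. \<Sum>l\<in>UNIV. K i l * (h i k \<bullet> d l)) * K j k
      - (\<Sum>p\<in>UNIV. \<Sum>q\<in>UNIV. K j p * (h p k \<bullet> d q + d p \<bullet> h q k) * K q k)) *\<^sub>R d j + K j k *\<^sub>R h j k) =
    R - (\<Sum>j\<in>UNIV. (\<Sum>p\<in>UNIV. K j p * (d p \<bullet> R)) *\<^sub>R d j)"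
proof -
  \<comment> \<open>By relabelling and the symmetries of \<open>K\<close> and \<open>h\<close>, the
    term from the volume density equals one half of the term from the inverse metric.\<close>
  have A: "(\<Sum>k\<in>UNIV. (\<Sum>i\<in>UNIV. \<Sum>l\<in>UNIV. K i l * (h i k \<bullet> d l)) * K j k) =
     (\<Sum>k\<in>UNIV. \<Sum>p\<in>UNIV. \<Sum>q\<in>UNIV. K j p * (h p k \<bullet> d q) * K q k)" for j
    unfolding sum_distrib_right
    by (subst (2) sum.swap) (auto intro!: sum.cong simp: h K)
  \<comment> \<open>In the other half the sums over \<open>k\<close> and \<open>q\<close> contract
    \<open>h\<close> with \<open>K\<close> to \<open>R\<close>.\<close>
  have C: "(\<Sum>k\<in>UNIV. \<Sum>p\<in>UNIV. \<Sum>q\<in>UNIV. K j p * (d p \<bullet> h q k) * K q k) = (\<Sum>p\<in>UNIV. K j p * (d p \<bullet> R))" for j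
    unfolding R_def inner_sum_right sum_distrib_left
    by (subst sum.swap) (simp add: mult_ac)
  have "(\<Sum>k\<in>UNIV. (\<Sum>i\<in>UNIV. \<Sum>l\<in>UNIV. K i l * (h i k \<bullet> d l)) * K j k
      - (\<Sum>p\<in>UNIV. \<Sum>q\<in>UNIV. K j p * (h p k \<bullet> d q + d p \<bullet> h q k) * K q k)) = - (\<Sum>p\<in>UNIV. K j p * (d p \<bullet> R))" for j
    unfolding C[symmetric] sum_subtractf A by (simp add: sum.distrib algebra_simps)
  then have "(\<Sum>j\<in>UNIV. (\<Sum>k\<in>UNIV. (\<Sum>i\<in>UNIV. \<Sum>l\<in>UNIV. K i l * (h i k \<bullet> d l)) * K j k
      - (\<Sum>p\<in>UNIV. \<Sum>q\<in>UNIV. K j p * (h p k \<bullet> d q + d p \<bullet> h q k) * K q k)) *\<^sub>R d j) =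
     - (\<Sum>j\<in>UNIV. (\<Sum>p\<in>UNIV. K j p * (d p \<bullet> R)) *\<^sub>R d j)"
    by (simp add: sum_negf)
  then show ?thesis
    unfolding sum.distrib scaleR_sum_left R_def by (subst sum.swap) simp
qed

section \<open>The minimal surface equation\<close>

lemma Ck_on_2D:
  fixes F :: "'a::euclidean_space \<Rightarrow> 'b::euclidean_space"
  assumes "Ck_on 2 U F" "x \<in> U"
  defines "D \<equiv> \<lambda>y. frechet_derivative F (at y)"
  shows "(F has_derivative D x) (at x)"
    and "((\<lambda>y. D y v) has_derivative frechet_derivative (\<lambda>y. D y v) (at x)) (at x)"
    and "continuous_on U (\<lambda>y. frechet_derivative (\<lambda>y. D y v) (at y) w)"
  using assms(1,2) by (auto simp: numeral_2_eq_2 D_def frechet_derivative_works)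

section \<open>Metric, inverse metric and flux of a C^2 map\<close>

locale C2_map =
  fixes U :: "(real^'n) set" and F :: "real^'n \<Rightarrow> real^'m"
  assumes open_U: "open U" and C2: "Ck_on 2 U F"
begin

definition D :: "real^'n \<Rightarrow> real^'n \<Rightarrow> real^'m" where
  "D x = frechet_derivative F (at x)"

definition H :: "real^'n \<Rightarrow> real^'n \<Rightarrow> real^'n \<Rightarrow> real^'m" where
  "H x v = frechet_derivative (\<lambda>y. D y v) (at x)"

abbreviation M :: "real^'n \<Rightarrow> real^'n^'n" where "M \<equiv> metric_matrix F"
abbreviation K :: "real^'n \<Rightarrow> real^'n^'n" where "K x \<equiv> matrix_inv (M x)"

definition R :: "real^'n \<Rightarrow> real^'m" where
  "R x = (\<Sum>k\<in>UNIV. \<Sum>j\<in>UNIV. K x $ j $ k *\<^sub>R H x (axis j 1) (axis k 1))"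

lemma D: "x \<in> U \<Longrightarrow> (F has_derivative D x) (at x)"
  and H: "x \<in> U \<Longrightarrow> ((\<lambda>y. D y v) has_derivative H x v) (at x)"
  and contH: "continuous_on U (\<lambda>y. H y v w)"
  using Ck_on_2D[OF C2] C2 unfolding D_def H_def by (blast, blast, simp add: numeral_2_eq_2)

lemma linear_D: "x \<in> U \<Longrightarrow> linear (D x)"
  using D has_derivative_linear by blast

lemma linear_H: "x \<in> U \<Longrightarrow> linear (H x v)"
  using H has_derivative_linear by blast

lemma H_symmetric: "x \<in> U \<Longrightarrow> H x v w = H x w v"
  using symmetric_second_derivative[OF open_U _ D H contH] by blast

lemma M_eq: "M x = matrix (G_op (D x))"
  by (simp add: metric_matrix_def D_def)

lemma M_entry: "x \<in> U \<Longrightarrow> M x $ i $ j = (if i = j then 1 else 0) + D x (axis i 1) \<bullet> D x (axis j 1)"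
proof -
  assume x: "x \<in> U"
  have "M x $ i $ j = G_op (D x) (axis j 1) \<bullet> axis i 1"
    by (simp add: M_eq matrix_def inner_axis)
  then show ?thesis
    by (auto simp: G_op_inner[OF linear_D[OF x]] inner_axis_axis inner_commute[of "D x (axis j 1)"])
qed

lemma M_K: "x \<in> U \<Longrightarrow> M x ** K x = mat 1"
  using matrix_mult_matrix_inv[OF invertible_matrix_G_op[OF linear_D]] by (simp add: M_eq)

lemma K_M: "x \<in> U \<Longrightarrow> K x ** M x = mat 1"
  using M_K matrix_left_right_inverse by blast

lemma K_symmetric: "x \<in> U \<Longrightarrow> K x $ i $ j = K x $ j $ i"
proof -
  assume x: "x \<in> U"
  have "transpose (M x) = M x" using transpose_matrix_G_op[OF linear_D[OF x]] by (simp add: M_eq)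
  then have "M x ** transpose (K x) = mat 1"
    using matrix_transpose_mul[of "K x" "M x"] by (simp add: K_M[OF x] transpose_mat)
  then have "(K x ** M x) ** transpose (K x) = K x"
    by (simp add: matrix_mul_assoc[symmetric])
  then have "transpose (K x) $ j $ i = K x $ j $ i"
    by (simp add: K_M[OF x])
  then show ?thesis by (simp add: transpose_def)
qed

text \<open>\<open>M\<close> is inverse to the square of \<open>inv_sqrt\<close>, so
  \<open>det M\<close> times a square is 1.\<close>

lemma det_M_pos: "x \<in> U \<Longrightarrow> det (M x) > 0"
proof -
  assume x: "x \<in> U"
  note lin = linear_D[OF x]
  let ?S = "inv_sqrt (G_op (D x))"
  have pd: "pos_def_op (G_op (D x))" by (rule G_op_pos_def[OF lin])
  have linS: "linear ?S" using inv_sqrt(1)[OF pd] by (simp add: pos_def_op_def)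
  have linG: "linear (G_op (D x))" using pd by (simp add: pos_def_op_def)
  have "M x ** (matrix ?S ** matrix ?S) = mat 1"
    unfolding matrix_eq M_eq
    using inv_sqrt_inv_sqrt_apply(1)[OF pd] matrix_vector_mul(2)[OF linS, THEN fun_cong] matrix_vector_mul(2)[OF linG, THEN fun_cong]
    by (simp add: matrix_vector_mul_assoc[symmetric])
  then have "det (M x ** (matrix ?S ** matrix ?S)) = 1" by simp
  then have d: "det (M x) * (det (matrix ?S))\<^sup>2 = 1"
    by (simp add: det_mul power2_eq_square)
  show ?thesis
  proof (rule ccontr)
    assume "\<not> det (M x) > 0"
    then have "det (M x) * (det (matrix ?S))\<^sup>2 \<le> 0" by (intro mult_nonpos_nonneg) auto
    with d show False by simp
  qed
qed

definition M' :: "real^'n \<Rightarrow> 'n \<Rightarrow> 'n \<Rightarrow> real^'n \<Rightarrow> real" where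
  "M' x i j w = H x (axis i 1) w \<bullet> D x (axis j 1) + D x (axis i 1) \<bullet> H x (axis j 1) w"

lemma M_has_derivative:
  assumes "x \<in> U" shows "((\<lambda>y. M y $ i $ j) has_derivative M' x i j) (at x)"
proof (rule has_derivative_transform_within_open[OF _ open_U assms])
  show "((\<lambda>y. (if i = j then 1 else 0) + D y (axis i 1) \<bullet> D y (axis j 1)) has_derivative M' x i j) (at x)"
    unfolding M'_def by (auto intro!: derivative_eq_intros H assms simp: fun_eq_iff)
qed (simp add: M_entry)

lemma det_M_has_derivative:
  assumes x: "x \<in> U"
  shows "((\<lambda>y. det (M y)) has_derivative
    (\<lambda>w. det (M x) * (\<Sum>i\<in>UNIV. \<Sum>j\<in>UNIV. M' x i j w * K x $ j $ i))) (at x)"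
  using has_derivative_det[of M "M' x" x, OF M_has_derivative[OF x]]
  by (simp add: det_replace_row[OF K_M[OF x]] sum_distrib_left)

text \<open>By symmetry of \<open>K\<close> the two summands of \<open>M'\<close> contribute
  equally, and their factor 2 cancels the one from the square root.\<close>

lemma sqrt_det_M_has_derivative:
  assumes x: "x \<in> U"
  shows "((\<lambda>y. sqrt (det (M y))) has_derivative
    (\<lambda>w. sqrt (det (M x)) * (\<Sum>i\<in>UNIV. \<Sum>j\<in>UNIV. K x $ i $ j * (H x (axis i 1) w \<bullet> D x (axis j 1))))) (at x)"
proof -
  let ?g = "det (M x)"
  define T where "T w = (\<Sum>i\<in>UNIV. \<Sum>j\<in>UNIV. K x $ i $ j * (H x (axis i 1) w \<bullet> D x (axis j 1)))" for w
  have "(\<Sum>i\<in>UNIV. \<Sum>j\<in>UNIV. M' x i j w * K x $ j $ i) = T w + T w" for w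
  proof -
    have "(\<Sum>i\<in>UNIV. \<Sum>j\<in>UNIV. (D x (axis i 1) \<bullet> H x (axis j 1) w) * K x $ j $ i) = T w"
      unfolding T_def by (subst sum.swap) (simp add: inner_commute mult.commute)
    moreover have "(\<Sum>i\<in>UNIV. \<Sum>j\<in>UNIV. (H x (axis i 1) w \<bullet> D x (axis j 1)) * K x $ j $ i) = T w"
      unfolding T_def by (simp add: K_symmetric[OF x] mult.commute)
    ultimately show ?thesis by (simp add: M'_def distrib_right sum.distrib)
  qed
  then have "((\<lambda>y. det (M y)) has_derivative (\<lambda>w. ?g * (T w + T w))) (at x)"
    using det_M_has_derivative[OF x] by (simp only:)
  then have "((\<lambda>y. sqrt (det (M y))) has_derivative (\<lambda>w. ?g * (T w + T w) * (inverse (sqrt ?g) / 2))) (at x)"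
    by (rule has_derivative_real_sqrt[where g = "\<lambda>y. det (M y)" and g' = "\<lambda>w. ?g * (T w + T w)" and x = x,
          OF det_M_pos[OF x]])
  moreover have "?g * (T w + T w) * (inverse (sqrt ?g) / 2) = sqrt ?g * T w" for w
  proof -
    have "a * (t + t) * (inverse r / 2) = (a / r) * t" for a t r :: real
      by (cases "r = 0") (simp_all add: field_simps)
    then show ?thesis using det_M_pos[OF x] by (simp only: real_div_sqrt less_imp_le)
  qed
  ultimately show ?thesis unfolding T_def by (simp only:)
qed

text \<open>Cramer's rule writes the entries as quotients of determinants. This has to come first,
  since the formula for the derivative is found by implicit differentiation.\<close>

lemma K_differentiable:
  assumes x: "x \<in> U" shows "(\<lambda>y. K y $ j $ k) differentiable (at x)"
proof -
  let ?C = "\<lambda>y. (\<chi> p q. if q = j then axis k 1 $ p else M y $ p $ q) :: real^'n^'n"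
  have "((\<lambda>y. ?C y $ p $ q) has_derivative (if q = j then (\<lambda>w. 0) else M' x p q)) (at x)" for p q
    using M_has_derivative[OF x] by (cases "q = j") simp_all
  from has_derivative_det[of ?C, OF this] have "(\<lambda>y. det (?C y)) differentiable (at x)"
    by (rule differentiableI)
  moreover have "(\<lambda>y. det (M y)) differentiable (at x)"
    using det_M_has_derivative[OF x] by (rule differentiableI)
  ultimately have "(\<lambda>y. det (?C y) / det (M y)) differentiable (at x)"
    using det_M_pos[OF x] by (intro differentiable_divide) auto
  then obtain C' where "((\<lambda>y. det (?C y) / det (M y)) has_derivative C') (at x)"
    by (auto simp: differentiable_def)
  moreover have "det (?C y) / det (M y) = K y $ j $ k" if "y \<in> U" for y
  proof -
    have "M y *v (K y *v axis k 1) = axis k 1"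
      by (simp add: matrix_vector_mul_assoc M_K[OF that])
    then have "K y *v axis k 1 = (\<chi> j. det (\<chi> p q. if q = j then axis k 1 $ p else M y $ p $ q) / det (M y))"
      using det_M_pos[OF that] by (intro cramer[THEN iffD1]) auto
    then have "(K y *v axis k 1) $ j = det (?C y) / det (M y)" by simp
    then show ?thesis by (simp add: matrix_vector_mult_basis column_def)
  qed
  ultimately have "((\<lambda>y. K y $ j $ k) has_derivative C') (at x)"
    by (rule has_derivative_transform_within_open[OF _ open_U x])
  then show ?thesis by (rule differentiableI)
qed

text \<open>Differentiating \<open>M K = 1\<close> gives \<open>M K' = - M' K\<close>, and
  multiplication by \<open>K\<close> from the left isolates \<open>K'\<close>.\<close>

lemma K_has_derivative:
  assumes x: "x \<in> U"
  shows "((\<lambda>y. K y $ j $ k) has_derivative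
     (\<lambda>w. - (\<Sum>p\<in>UNIV. \<Sum>q\<in>UNIV. K x $ j $ p * M' x p q w * K x $ q $ k))) (at x)"
proof -
  define K' where "K' j k = frechet_derivative (\<lambda>y. K y $ j $ k) (at x)" for j k
  have K': "((\<lambda>y. K y $ j $ k) has_derivative K' j k) (at x)" for j k
    using K_differentiable[OF x] by (simp add: K'_def frechet_derivative_works)
  have E: "(\<Sum>q\<in>UNIV. M x $ p $ q * K' q k w) = - (\<Sum>q\<in>UNIV. M' x p q w * K x $ q $ k)" for p k w
  proof -
    have "((\<lambda>y. \<Sum>q\<in>UNIV. M y $ p $ q * K y $ q $ k) has_derivative
        (\<lambda>w. \<Sum>q\<in>UNIV. M x $ p $ q * K' q k w + M' x p q w * K x $ q $ k)) (at x)"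
      by (intro has_derivative_sum has_derivative_mult M_has_derivative[OF x] K')
    moreover have "((\<lambda>y. \<Sum>q\<in>UNIV. M y $ p $ q * K y $ q $ k) has_derivative (\<lambda>w. 0)) (at x)"
    proof (rule has_derivative_transform_within_open[OF _ open_U x])
      show "((\<lambda>y. mat 1 $ p $ k :: real) has_derivative (\<lambda>w. 0)) (at x)" by simp
      show "mat 1 $ p $ k = (\<Sum>q\<in>UNIV. M y $ p $ q * K y $ q $ k)" if "y \<in> U" for y
        unfolding M_K[OF that, symmetric] by (simp add: matrix_matrix_mult_def)
    qed
    ultimately have "(\<lambda>w. \<Sum>q\<in>UNIV. M x $ p $ q * K' q k w + M' x p q w * K x $ q $ k) = (\<lambda>w. 0)"
      by (rule has_derivative_unique)
    then show ?thesis by (simp add: fun_eq_iff sum.distrib eq_neg_iff_add_eq_0)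
  qed
  have "K' j k w = - (\<Sum>p\<in>UNIV. \<Sum>q\<in>UNIV. K x $ j $ p * M' x p q w * K x $ q $ k)" for w
  proof -
    have "K' j k w = (\<Sum>q\<in>UNIV. (K x ** M x) $ j $ q * K' q k w)"
      by (simp add: K_M[OF x] mat_def if_distrib if_distribR cong: if_cong)
    also have "\<dots> = (\<Sum>p\<in>UNIV. K x $ j $ p * (\<Sum>q\<in>UNIV. M x $ p $ q * K' q k w))"
      unfolding matrix_matrix_mult_def vec_lambda_beta sum_distrib_left sum_distrib_right
      by (subst sum.swap) (simp add: mult.assoc)
    finally show ?thesis by (simp add: E sum_negf sum_distrib_left mult.assoc)
  qed
  then have "K' j k = (\<lambda>w. - (\<Sum>p\<in>UNIV. \<Sum>q\<in>UNIV. K x $ j $ p * M' x p q w * K x $ q $ k))"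
    by (rule ext)
  then show ?thesis using K'[of j k] by (simp only:)
qed

lemma flux_eq:
  "flux F y k = sqrt (det (M y)) *\<^sub>R (\<Sum>j\<in>UNIV. K y $ j $ k *\<^sub>R D y (axis j 1))" if "y \<in> U"
proof -
  have "K y *v axis k 1 = (\<Sum>j\<in>UNIV. K y $ j $ k *\<^sub>R axis j 1)"
    using basis_expansion[of "K y *v axis k 1"] 
    by (simp add: matrix_vector_mult_basis column_def scalar_mult_eq_scaleR)
  then show ?thesis
    by (simp add: flux_def D_def[symmetric] linear_sum[OF linear_D[OF that]] linear_scale[OF linear_D[OF that]])
qed

text \<open>The product rule with \<open>sqrt g\<close> taken out; the bracket is arranged to match
  the summand of \<open>divergence_cancellation\<close>.\<close>

lemma flux_has_derivative:
  assumes x: "x \<in> U"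
  shows "((\<lambda>y. flux F y k) has_derivative (\<lambda>w. sqrt (det (M x)) *\<^sub>R (\<Sum>j\<in>UNIV.
      ((\<Sum>i\<in>UNIV. \<Sum>l\<in>UNIV. K x $ i $ l * (H x (axis i 1) w \<bullet> D x (axis l 1))) * K x $ j $ k
      - (\<Sum>p\<in>UNIV. \<Sum>q\<in>UNIV. K x $ j $ p * M' x p q w * K x $ q $ k)) *\<^sub>R D x (axis j 1)
      + K x $ j $ k *\<^sub>R H x (axis j 1) w))) (at x)"
proof (rule has_derivative_transform_within_open[OF _ open_U x])
  define T where "T w = (\<Sum>i\<in>UNIV. \<Sum>l\<in>UNIV. K x $ i $ l * (H x (axis i 1) w \<bullet> D x (axis l 1)))" for w
  define K' where "K' j k w = (\<Sum>p\<in>UNIV. \<Sum>q\<in>UNIV. K x $ j $ p * M' x p q w * K x $ q $ k)" for j k w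
  have "((\<lambda>y. sqrt (det (M y)) *\<^sub>R (\<Sum>j\<in>UNIV. K y $ j $ k *\<^sub>R D y (axis j 1))) has_derivative
     (\<lambda>w. sqrt (det (M x)) *\<^sub>R (\<Sum>j\<in>UNIV. K x $ j $ k *\<^sub>R H x (axis j 1) w + (- K' j k w) *\<^sub>R D x (axis j 1))
       + (sqrt (det (M x)) * T w) *\<^sub>R (\<Sum>j\<in>UNIV. K x $ j $ k *\<^sub>R D x (axis j 1)))) (at x)"
    unfolding T_def K'_def
    by (intro has_derivative_scaleR has_derivative_sum H K_has_derivative sqrt_det_M_has_derivative x)
  then show "((\<lambda>y. sqrt (det (M y)) *\<^sub>R (\<Sum>j\<in>UNIV. K y $ j $ k *\<^sub>R D y (axis j 1))) has_derivative
     (\<lambda>w. sqrt (det (M x)) *\<^sub>R (\<Sum>j\<in>UNIV.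
      ((\<Sum>i\<in>UNIV. \<Sum>l\<in>UNIV. K x $ i $ l * (H x (axis i 1) w \<bullet> D x (axis l 1))) * K x $ j $ k
      - (\<Sum>p\<in>UNIV. \<Sum>q\<in>UNIV. K x $ j $ p * M' x p q w * K x $ q $ k)) *\<^sub>R D x (axis j 1)
      + K x $ j $ k *\<^sub>R H x (axis j 1) w))) (at x)"
    unfolding T_def[symmetric] K'_def[symmetric]
    by (rule has_derivative_eq_rhs)
      (simp add: fun_eq_iff sum.distrib sum_subtractf sum_negf scaleR_add_left scaleR_diff_left
        scaleR_sum_right algebra_simps)
qed (simp add: flux_eq)

lemma horizontal_coeff_differentiable:
  assumes x: "x \<in> U" shows "horizontal_coeff F differentiable (at x)"
  unfolding horizontal_coeff_def
  using differentiableI[OF sqrt_det_M_has_derivative[OF x]] K_differentiable[OF x]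
  by (intro differentiable_mult differentiable_add differentiable_diff differentiable_sum differentiable_const) auto

lemma divergence_flux:
  assumes x: "x \<in> U"
  shows "(\<Sum>k\<in>UNIV. frechet_derivative (\<lambda>y. flux F y k) (at x) (axis k 1)) =
    sqrt (det (M x)) *\<^sub>R (R x - D x (K x *v adjoint (D x) (R x)))"
proof -
  have "frechet_derivative (\<lambda>y. flux F y k) (at x) (axis k 1) = sqrt (det (M x)) *\<^sub>R (\<Sum>j\<in>UNIV.
      ((\<Sum>i\<in>UNIV. \<Sum>l\<in>UNIV. K x $ i $ l * (H x (axis i 1) (axis k 1) \<bullet> D x (axis l 1))) * K x $ j $ k
      - (\<Sum>p\<in>UNIV. \<Sum>q\<in>UNIV. K x $ j $ p * M' x p q (axis k 1) * K x $ q $ k)) *\<^sub>R D x (axis j 1)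
      + K x $ j $ k *\<^sub>R H x (axis j 1) (axis k 1))" for k
    unfolding frechet_derivative_at[OF flux_has_derivative[OF x], symmetric] ..
  note fd = this
  have "(\<Sum>k\<in>UNIV. frechet_derivative (\<lambda>y. flux F y k) (at x) (axis k 1)) = 
     sqrt (det (M x)) *\<^sub>R (R x - (\<Sum>j\<in>UNIV. (\<Sum>p\<in>UNIV. K x $ j $ p * (D x (axis p 1) \<bullet> R x)) *\<^sub>R D x (axis j 1)))"
    using divergence_cancellation[of "\<lambda>i j. K x $ i $ j" "\<lambda>i k. H x (axis i 1) (axis k 1)" "\<lambda>i. D x (axis i 1)",
        OF K_symmetric[OF x] H_symmetric[OF x]]
    by (simp only: fd scaleR_sum_right[symmetric] M'_def R_def)
  also have "(\<Sum>j\<in>UNIV. (\<Sum>p\<in>UNIV. K x $ j $ p * (D x (axis p 1) \<bullet> R x)) *\<^sub>R D x (axis j 1)) =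
     D x (K x *v adjoint (D x) (R x))"
  proof -
    note lin = linear_D[OF x]
    have "(K x *v adjoint (D x) (R x)) $ j = (\<Sum>p\<in>UNIV. K x $ j $ p * (D x (axis p 1) \<bullet> R x))" for j
    proof -
      have "adjoint (D x) (R x) $ p = D x (axis p 1) \<bullet> R x" for p
        using adjoint_works[OF lin, of "axis p 1" "R x"] by (simp add: inner_axis')
      then show ?thesis by (simp add: matrix_vector_mult_def)
    qed
    note comp = this
    have "D x v = (\<Sum>j\<in>UNIV. v $ j *\<^sub>R D x (axis j 1))" for v
    proof -
      have "v = (\<Sum>j\<in>UNIV. v $ j *\<^sub>R axis j 1)"
        using basis_expansion[of v] by (simp add: scalar_mult_eq_scaleR)
      then have "D x v = D x (\<Sum>j\<in>UNIV. v $ j *\<^sub>R axis j 1)" by (rule arg_cong)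
      then show ?thesis by (simp only: linear_sum[OF lin] linear_scale[OF lin])
    qed
    from this[of "K x *v adjoint (D x) (R x)"] show ?thesis by (simp only: comp)
  qed
  finally show ?thesis .
qed

text \<open>The operator applied to \<open>R\<close> above is \<open>(I + D D\<^sup>*)\<^sup>-\<^sup>1\<close>.\<close>
lemma divergence_flux_eq_0_iff:
  assumes x: "x \<in> U"
  shows "(\<Sum>k\<in>UNIV. frechet_derivative (\<lambda>y. flux F y k) (at x) (axis k 1)) = 0 \<longleftrightarrow> R x = 0"
proof -
  note lin = linear_D[OF x]
  define s where "s = K x *v adjoint (D x) (R x)"
  have Gs: "G_op (D x) s = adjoint (D x) (R x)"
    unfolding s_def M_eq by (rule G_op_matrix_inv[OF lin])
  have "R x = 0" if "R x = D x s"
  proof -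
    \<comment> \<open>Here \<open>G s = s + D^* D s\<close>, while the right side
      \<open>D^* R\<close> is now \<open>D^* D s\<close>.\<close>
    have "s = 0" using Gs unfolding that G_op_def by simp
    then show ?thesis using that linear_0[OF lin] by simp
  qed
  moreover have "s = 0" if "R x = 0"
    using that linear_0[OF adjoint_linear[OF lin]] by (simp add: s_def)
  ultimately show ?thesis
    using det_M_pos[OF x] linear_0[OF lin] by (auto simp: divergence_flux[OF x] s_def[symmetric])
qed

lemma second_derivative_graph_map:
  assumes x: "x \<in> U"
  shows "frechet_derivative (\<lambda>y. frechet_derivative (graph_map F) (at y) v) (at x) u = (0, H x v u)"
proof -
  have d: "frechet_derivative (graph_map F) (at y) v = (v, D y v)" if "y \<in> U" for y
  proof -
    have "(graph_map F has_derivative (\<lambda>u. (u, D y u))) (at y)"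
      unfolding graph_map_def[abs_def] by (intro has_derivative_Pair has_derivative_ident D that)
    then show ?thesis using frechet_derivative_at by metis
  qed
  have "((\<lambda>y. frechet_derivative (graph_map F) (at y) v) has_derivative (\<lambda>u. (0, H x v u))) (at x)"
  proof (rule has_derivative_transform_within_open[OF _ open_U x])
    show "((\<lambda>y. (v, D y v)) has_derivative (\<lambda>u. (0, H x v u))) (at x)"
      by (intro has_derivative_Pair has_derivative_const H x)
  qed (simp add: d)
  then show ?thesis using frechet_derivative_at by metis
qed

lemma H_expand:
  assumes x: "x \<in> U"
  shows "H x v w = (\<Sum>k\<in>UNIV. \<Sum>j\<in>UNIV. (v $ j * w $ k) *\<^sub>R H x (axis j 1) (axis k 1))"
proof -
  have e: "u = (\<Sum>k\<in>UNIV. u $ k *\<^sub>R axis k 1)" for u :: "real^'n"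
    using basis_expansion[of u] by (simp add: scalar_mult_eq_scaleR)
  have L: "H x a u = (\<Sum>k\<in>UNIV. u $ k *\<^sub>R H x a (axis k 1))" for a u
    by (subst e[of u]) (simp only: linear_sum[OF linear_H[OF x]] linear_scale[OF linear_H[OF x]])
  have "H x v w = (\<Sum>k\<in>UNIV. w $ k *\<^sub>R H x (axis k 1) v)"
    by (subst L) (simp add: H_symmetric[OF x, of v])
  also have "\<dots> = (\<Sum>k\<in>UNIV. \<Sum>j\<in>UNIV. (v $ j * w $ k) *\<^sub>R H x (axis j 1) (axis k 1))"
    by (subst L) (simp add: scaleR_sum_right H_symmetric[OF x, of "axis _ 1" "axis _ 1"] mult.commute)
  finally show ?thesis .
qed

end

section \<open>Normal projection and mean curvature\<close>

lemma orthonormal_basis_of_sum_mem: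
  assumes "orthonormal_basis_of T es"
  shows "(\<Sum>e\<leftarrow>es. (e \<bullet> v) *\<^sub>R e) \<in> T"
proof -
  have T: "subspace T" by (rule orthonormal_basis_of_subspace[OF assms])
  have "\<forall>e\<in>set es'. e \<in> T \<Longrightarrow> (\<Sum>e\<leftarrow>es'. (e \<bullet> v) *\<^sub>R e) \<in> T" for es'
    by (induction es') (auto intro: subspace_add[OF T] subspace_scale[OF T] subspace_0[OF T])
  then show ?thesis using orthonormal_basis_of_mem[OF assms] by blast
qed

text \<open>Makes the definite description computable: two candidates differ by a vector lying both
  in \<open>T\<close> and in its orthogonal complement.\<close>

lemma normal_part_eq:
  assumes "orthonormal_basis_of T es"
  shows "normal_part T v = v - (\<Sum>e\<leftarrow>es. (e \<bullet> v) *\<^sub>R e)"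
  unfolding normal_part_def
proof (rule the_equality)
  let ?p = "\<Sum>e\<leftarrow>es. (e \<bullet> v) *\<^sub>R e"
  have T: "subspace T" by (rule orthonormal_basis_of_subspace[OF assms])
  have p: "?p \<in> T" by (rule orthonormal_basis_of_sum_mem[OF assms])
  have o: "v - ?p \<in> T\<^sup>\<bottom>"
  proof -
    have "y \<bullet> (v - ?p) = 0" if "y \<in> T" for y
      using orthonormal_basis_of_projection[OF assms that, of v] by (subst inner_commute)
    then show ?thesis by (simp add: orthogonal_comp_def orthogonal_def)
  qed
  show "v - ?p \<in> T\<^sup>\<bottom> \<and> v - (v - ?p) \<in> T" using p o by simp
  fix w assume w: "w \<in> T\<^sup>\<bottom> \<and> v - w \<in> T"
  have "(v - w) - ?p \<in> T" using w p T by (simp add: subspace_diff)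
  moreover have "(v - ?p) - w \<in> T\<^sup>\<bottom>" using w o subspace_diff[OF subspace_orthogonal_comp] by blast
  moreover have "(v - w) - ?p = (v - ?p) - w" by simp
  ultimately have "((v - ?p) - w) \<bullet> ((v - ?p) - w) = 0"
    by (auto simp: orthogonal_comp_def orthogonal_def)
  then show "w = v - ?p" by simp
qed

lemma normal_part_linear: "orthonormal_basis_of T es \<Longrightarrow> linear (normal_part T)"
proof -
  assume onb: "orthonormal_basis_of T es"
  have "linear (\<lambda>v. v - (\<Sum>e\<leftarrow>es'. (e \<bullet> v) *\<^sub>R e))" for es' :: "'a list"
    by (induction es') (auto simp: linear_iff inner_add_right algebra_simps)
  moreover have "normal_part T = (\<lambda>v. v - (\<Sum>e\<leftarrow>es. (e \<bullet> v) *\<^sub>R e))"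
    by (rule ext) (rule normal_part_eq[OF onb])
  ultimately show ?thesis by (simp only:)
qed

lemma normal_part_eq_0_iff:
  assumes "orthonormal_basis_of T es" shows "normal_part T v = 0 \<longleftrightarrow> v \<in> T"
proof -
  have T: "subspace T" by (rule orthonormal_basis_of_subspace[OF assms])
  have p: "(\<Sum>e\<leftarrow>es. (e \<bullet> v) *\<^sub>R e) \<in> T" by (rule orthonormal_basis_of_sum_mem[OF assms])
  show ?thesis
  proof
    assume "normal_part T v = 0"
    then show "v \<in> T" using p by (simp add: normal_part_eq[OF assms])
  next
    assume v: "v \<in> T"
    then have "v - (\<Sum>e\<leftarrow>es. (e \<bullet> v) *\<^sub>R e) \<in> T" using p T by (simp add: subspace_diff)
    from orthonormal_basis_of_projection[OF assms this, of v] show "normal_part T v = 0"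
      by (simp add: normal_part_eq[OF assms])
  qed
qed

context C2_map
begin

text \<open>The second derivative of the graph map is vertical, and its trace over the frame is
  \<open>(0, R x)\<close>. The normal part vanishes only if this vector is tangent, and a tangent
  vector \<open>(u, D u)\<close> with \<open>u = 0\<close> is zero.\<close>

lemma mean_curvature_eq_0_iff:
  assumes x: "x \<in> U" shows "mean_curvature (graph_map F) x = 0 \<longleftrightarrow> R x = 0"
proof -
  note lin = linear_D[OF x]
  define T where "T = tangent_space (graph_map F) x"
  have T: "T = range (\<lambda>u. (u, D x u))"
    unfolding T_def D_def using D[OF x] by (intro tangent_space_graph_map) (rule differentiableI)
  define es where "es = (SOME es. orthonormal_basis_of T es)"
  have onb: "orthonormal_basis_of T es"
    unfolding es_def by (rule someI_ex) (metis T orthonormal_basis_of_exists[OF subspace_graph[OF lin]])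
  note onb' = onb[unfolded T]
  let ?\<phi> = "frechet_derivative (graph_map F) (at x)"
  have \<phi>: "?\<phi> = (\<lambda>u. (u, D x u))"
  proof -
    have "(graph_map F has_derivative (\<lambda>u. (u, D x u))) (at x)"
      unfolding graph_map_def[abs_def] by (intro has_derivative_Pair has_derivative_ident D x)
    then show ?thesis using frechet_derivative_at by metis
  qed
  have inv: "inv ?\<phi> e = fst e" if "e \<in> set es" for e
  proof -
    have "inj ?\<phi>" unfolding \<phi> by (auto simp: inj_def)
    moreover have "?\<phi> (fst e) = e"
      unfolding \<phi> using graph_frame_snd[OF lin onb' that] by (simp add: prod_eq_iff)
    ultimately show ?thesis using inv_f_f[of ?\<phi> "fst e"] by simp
  qed
  have "second_fundamental_form (graph_map F) x e e = normal_part T (0, H x (fst e) (fst e))" if "e \<in> set es" for e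
    unfolding second_fundamental_form_def Let_def inv[OF that] second_derivative_graph_map[OF x] T_def ..
  then have "mean_curvature (graph_map F) x = (1 / real DIM(real^'n)) *\<^sub>R (\<Sum>e\<leftarrow>es. normal_part T (0, H x (fst e) (fst e)))"
    unfolding mean_curvature_def Let_def T_def[symmetric] es_def[symmetric] by (simp cong: map_cong)
  also have "(\<Sum>e\<leftarrow>es. normal_part T (0, H x (fst e) (fst e))) = normal_part T (\<Sum>e\<leftarrow>es. (0, H x (fst e) (fst e)))"
    by (rule linear_sum_list[OF normal_part_linear[OF onb], symmetric])
  also have "(\<Sum>e\<leftarrow>es. (0 :: real^'n, H x (fst e) (fst e))) = (0, R x)"
  proof -
    have K: "(\<Sum>e\<leftarrow>es. fst e $ j * fst e $ k) = K x $ j $ k" for j k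
    proof -
      have "(\<Sum>e\<leftarrow>es. (fst e \<bullet> axis k 1) *\<^sub>R fst e) = K x *v axis k 1"
        unfolding M_eq
        by (rule injD[OF bij_is_inj[OF G_op_bij[OF lin]]])
          (simp only: graph_frame_sum[OF lin onb'] G_op_matrix_inv[OF lin])
      then have "(\<Sum>e\<leftarrow>es. (fst e \<bullet> axis k 1) *\<^sub>R fst e) $ j = K x $ j $ k"
        by (simp add: matrix_vector_mult_basis column_def)
      moreover have "linear (\<lambda>v :: real^'n. v $ j)" by (simp add: linear_iff)
      from linear_sum_list[OF this, of "\<lambda>e. (fst e \<bullet> axis k 1) *\<^sub>R fst e" es]
      have "(\<Sum>e\<leftarrow>es. (fst e \<bullet> axis k 1) *\<^sub>R fst e) $ j = (\<Sum>e\<leftarrow>es. fst e $ j * fst e $ k)"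
        by (simp add: inner_axis mult.commute)
      ultimately show ?thesis by simp
    qed
    \<comment> \<open>Stated for an arbitrary list, since sublists of the frame are no longer
      bases.\<close>
    have "(\<Sum>e\<leftarrow>es'. (0 :: real^'n, H x (fst e) (fst e))) = 
       (0, \<Sum>k\<in>UNIV. \<Sum>j\<in>UNIV. (\<Sum>e\<leftarrow>es'. fst e $ j * fst e $ k) *\<^sub>R H x (axis j 1) (axis k 1))" 
       for es' :: "((real^'n) \<times> (real^'m)) list"
    proof (induction es')
      case (Cons e es')
      have "H x (fst e) (fst e) = (\<Sum>k\<in>UNIV. \<Sum>j\<in>UNIV. (fst e $ j * fst e $ k) *\<^sub>R H x (axis j 1) (axis k 1))"
        by (rule H_expand[OF x])
      then show ?case using Cons by (simp add: scaleR_add_left sum.distrib)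
    qed (simp add: zero_prod_def)
    then show ?thesis by (simp add: K R_def)
  qed
  finally have "mean_curvature (graph_map F) x = 0 \<longleftrightarrow> normal_part T (0, R x) = 0"
    by simp
  also have "\<dots> \<longleftrightarrow> (0, R x) \<in> T" by (rule normal_part_eq_0_iff[OF onb])
  also have "\<dots> \<longleftrightarrow> R x = 0" unfolding T using linear_0[OF lin] by (auto simp: image_iff)
  finally show ?thesis .
qed

end

theorem theorem3p3:
  fixes U :: "(real ^ 'n::{finite,linorder}) set"
    and F :: "real ^ 'n::{finite,linorder} \<Rightarrow> real ^ 'm::finite"
  assumes "open U" and "connected U" and "U \<noteq> {}"
    and "smooth_on U F"
  shows "closed_form_on CARD('n) (U \<times> UNIV) (Theta_form F) \<longleftrightarrow> minimal_on U (graph_map F)"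
proof -
  interpret C2_map U F
    using assms by unfold_locales (auto simp: smooth_on_def)
  have "closed_form_on CARD('n) (U \<times> UNIV) (Theta_form F) \<longleftrightarrow>
    (\<forall>x\<in>U. (\<Sum>k\<in>UNIV. frechet_derivative (\<lambda>y. flux F y k) (at x) (axis k 1)) = 0)"
    by (intro closed_Theta_form_iff assms differentiableI[OF D] horizontal_coeff_differentiable
        differentiableI[OF flux_has_derivative])
  then show ?thesis
    by (simp add: divergence_flux_eq_0_iff minimal_on_def mean_curvature_eq_0_iff)
qed

end
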